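(* $\mathcal{L}_{\rm V}(\mathbb{RDBLP}) \cong \mathcal{L}_{\rm V}(\mathbb{RDPCH}) \cong \mathcal{L}_{\rm V}(\mathbb{RPCH}^d) \cong \mathcal{L}_{\rm V}(\mathbb{RDBLH})$ (isomorphism of lattices), where $\mathcal{L}_{\rm V}(\mathbb V)$ denotes the lattice of subvarieties of the variety $\mathbb V$, ordered by inclusion.
   Context: All algebras below have a bounded distributive lattice reduct $\langle A,\vee,\wedge,0,1\rangle$. Notation for the operations: $x^*$ is the largest $z$ with $x\wedge z=0$; $x^+$ is the least $z$ with $x\vee z=1$; $x\to y$ is the largest $z$ with $x\wedge z\le y$; $x\leftarrow y$ is the least $z$ with $y\le x\vee z$. Where ${}^*$ is not basic, $x^*:=x\to 0$; where ${}^+$ is not basic, $x^+:=x\leftarrow 1$. The regularity identity is (M): $(x\wedge x^+)\vee(y\vee y^* )\approx y\vee y^*$ (for double p-algebras it is known to be equivalent to: $x^*=y^*$ and $x^+=y^+$ imply $x=y$). $\mathbb{RDBLP}$ (regular double p-algebras): algebras $\langle A,\vee,\wedge,{}^*,{}^+,0,1\rangle$ satisfying (M). $\mathbb{RDPCH}$ (regular dually pseudocomplemented Heyting algebras): algebras $\langle A,\vee,\wedge,\to,{}^+,0,1\rangle$ satisfying (M). $\mathbb{RPCH}^d$ (regular pseudocomplemented dual Heyting algebras): algebras $\langle A,\vee,\wedge,{}^*,\leftarrow,0,1\rangle$ satisfying (M). $\mathbb{RDBLH}$ (regular double Heyting algebras): algebras $\langle A,\vee,\wedge,\to,\leftarrow,0,1\rangle$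 satisfying (M). *)

theory Defs
  imports "HOL-Algebra.Lattice" "HOL-Library.FuncSet" "HOL-Library.Countable_Set"
begin

section \<open>Algebras, identities and varieties\<close>

text \<open>
  All the types of algebras considered here draw their operation symbols from one fixed list;
  a type is given by the set \<open>F\<close> of symbols it uses.
\<close>

datatype opsym = Join | Meet | Zero | One | Star | Plus | Imp | Coimp

fun arity :: "opsym \<Rightarrow> nat" where
  "arity Zero = 0"
| "arity One = 0"
| "arity Star = 1"
| "arity Plus = 1"
| "arity Join = 2"
| "arity Meet = 2"
| "arity Imp = 2"
| "arity Coimp = 2"

record 'a alg = "'a partial_object" +
  interp :: "opsym \<Rightarrow> 'a list \<Rightarrow> 'a"

definition tuples :: "('a, 'b) partial_object_scheme \<Rightarrow> nat \<Rightarrow> 'a list set" where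
  "tuples A n = {xs. length xs = n \<and> set xs \<subseteq> carrier A}"

text \<open>
  The extensional function spaces make an algebra of type \<open>F\<close> carry nothing but its carrier and the
  operations in \<open>F\<close>: outside \<open>F\<close>, and outside the carrier, the interpretation is \<open>undefined\<close>.
\<close>

definition is_algebra :: "opsym set \<Rightarrow> 'a alg \<Rightarrow> bool" where
  "is_algebra F A \<longleftrightarrow> carrier A \<noteq> {} \<and>
     interp A \<in> (\<Pi>\<^sub>E f\<in>F. tuples A (arity f) \<rightarrow>\<^sub>E carrier A)"

datatype trm = Var nat | App opsym "trm list"

inductive_set trms :: "opsym set \<Rightarrow> trm set" for F :: "opsym set" where
  Var: "Var n \<in> trms F"
| App: "\<lbrakk>f \<in> F; length ts = arity f; \<forall>t \<in> set ts. t \<in> trms F\<rbrakk> \<Longrightarrow> App f ts \<in> trms F"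

primrec eval :: "'a alg \<Rightarrow> (nat \<Rightarrow> 'a) \<Rightarrow> trm \<Rightarrow> 'a" where
  "eval A v (Var n) = v n"
| "eval A v (App f ts) = interp A f (map (eval A v) ts)"

definition satisfies :: "'a alg \<Rightarrow> trm \<times> trm \<Rightarrow> bool" where
  "satisfies A e \<longleftrightarrow> (\<forall>v \<in> UNIV \<rightarrow> carrier A. eval A v (fst e) = eval A v (snd e))"

definition models :: "opsym set \<Rightarrow> (trm \<times> trm) set \<Rightarrow> 'a alg set" where
  "models F E = {A. is_algebra F A \<and> (\<forall>e \<in> E. satisfies A e)}"

definition variety :: "opsym set \<Rightarrow> 'a alg set \<Rightarrow> bool" where
  "variety F K \<longleftrightarrow> (\<exists>E. E \<subseteq> trms F \<times> trms F \<and> K = models F E)"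

text \<open>
  A class of algebras is represented by its members whose carrier is a subset of the type \<open>'a\<close>.
  When \<open>'a\<close> is infinite this loses nothing: an identity that fails in some algebra of a variety,
  over any type whatsoever, already fails in a countable one, which has a copy inside \<open>'a\<close>.
  So the inclusions between varieties are the same as for the classes of all algebras.
\<close>

instance opsym :: countable by countable_datatype
instance trm :: countable by countable_datatype

lemma eval_closed:
  assumes "is_algebra F A" "v \<in> UNIV \<rightarrow> carrier A" "t \<in> trms F"
  shows "eval A v t \<in> carrier A"
  using assms(3)
proof induction
  case (App f ts)
  have "map (eval A v) ts \<in> tuples A (arity f)"
    using App unfolding tuples_def by auto
  moreover have "interp A f \<in> tuples A (arity f) \<rightarrow>\<^sub>E carrier A"
    using assms(1) App(1) unfolding is_algebra_def by (auto dest: PiE_mem)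
  ultimately show ?case by (auto dest: PiE_mem)
qed (use assms in auto)

lemma identities_determined_in_infinite_type:
  fixes A :: "'b alg"
  assumes inf: "infinite (UNIV :: 'a set)"
    and E: "E \<subseteq> trms F \<times> trms F" and A: "A \<in> models F E"
    and e: "e \<in> trms F \<times> trms F" "\<not> satisfies A e"
  shows "\<exists>B :: 'a alg. B \<in> models F E \<and> \<not> satisfies B e"
proof -
  obtain v where v: "v \<in> UNIV \<rightarrow> carrier A" "eval A v (fst e) \<noteq> eval A v (snd e)"
    using e(2) unfolding satisfies_def by blast
  have algA: "is_algebra F A" using A unfolding models_def by blast
  define S where "S = eval A v ` trms F"
  have S: "S \<subseteq> carrier A" unfolding S_def using eval_closed[OF algA v(1)] by auto
  have vS: "v n \<in> S" for n unfolding S_def using trms.Var[of n F] by force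
  have "countable S" unfolding S_def by simp
  moreover obtain h :: "nat \<Rightarrow> 'a" where "inj h"
    using inf infinite_countable_subset by blast
  ultimately obtain g :: "'b \<Rightarrow> 'a" where g: "inj_on g S"
    using comp_inj_on[of "to_nat_on S" S h] inj_on_to_nat_on inj_on_subset by (metis subset_UNIV)
  define k where "k = inv_into S g"
  have kg: "k (g x) = x" if "x \<in> S" for x
    using that g unfolding k_def by (simp add: inv_into_f_f)
  have kS: "k y \<in> S" if "y \<in> g ` S" for y
    using that unfolding k_def by (simp add: inv_into_into)
  have gk: "g (k y) = y" if "y \<in> g ` S" for y
    using that unfolding k_def by (simp add: f_inv_into_f)
  have opS: "interp A f xs \<in> S" if f: "f \<in> F" "length xs = arity f" "set xs \<subseteq> S" for f xs
  proof -
    have "\<forall>x \<in> set xs. \<exists>t \<in> trms F. x = eval A v t"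
      using f unfolding S_def by auto
    then obtain c where c: "\<And>x. x \<in> set xs \<Longrightarrow> c x \<in> trms F \<and> x = eval A v (c x)" by metis
    then have "map (eval A v) (map c xs) = xs" by (auto intro: map_idI)
    then have "interp A f xs = eval A v (App f (map c xs))" by simp
    moreover have "App f (map c xs) \<in> trms F" using f c by (auto intro!: trms.App)
    ultimately show ?thesis unfolding S_def by blast
  qed
  define B :: "'a alg" where "B = \<lparr>carrier = g ` S,
    interp = (\<lambda>f\<in>F. \<lambda>xs\<in>{xs. length xs = arity f \<and> set xs \<subseteq> g ` S}. g (interp A f (map k xs)))\<rparr>"
  have algB: "is_algebra F B"
    unfolding is_algebra_def
  proof (intro conjI PiE_I)
    fix f xs assume "f \<in> F" "xs \<in> tuples B (arity f)"
    then have f: "f \<in> F" "length xs = arity f" "set xs \<subseteq> g ` S" by (auto simp: B_def tuples_def)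
    then have "set (map k xs) \<subseteq> S" using kS unfolding set_map by blast
    then have "interp A f (map k xs) \<in> S" using f by (intro opS) auto
    then show "interp B f xs \<in> carrier B" using f by (simp add: B_def)
  qed (use vS in \<open>auto simp: B_def tuples_def\<close>)
  have ev: "eval A (k \<circ> w) t \<in> S \<and> eval B w t = g (eval A (k \<circ> w) t)"
    if w: "w \<in> UNIV \<rightarrow> g ` S" and t: "t \<in> trms F" for w t
    using t
  proof induction
    case (Var n)
    have "w n \<in> g ` S" using w by auto
    then show ?case using kS gk by auto
  next
    case (App f ts)
    have eq: "map k (map (eval B w) ts) = map (eval A (k \<circ> w)) ts"
      using App kg by (simp add: comp_def)
    have "set (map (eval B w) ts) \<subseteq> g ` S" using App by auto
    then have "eval B w (App f ts) = g (interp A f (map k (map (eval B w) ts)))"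
      using App(1,2) by (simp add: B_def)
    moreover have "interp A f (map (eval A (k \<circ> w)) ts) \<in> S"
      using App by (intro opS) (auto simp: comp_def)
    ultimately show ?case unfolding eq by (simp add: comp_def)
  qed
  have "satisfies B d" if d: "d \<in> E" for d
    unfolding satisfies_def
  proof
    fix w :: "nat \<Rightarrow> 'a" assume "w \<in> UNIV \<rightarrow> carrier B"
    then have w: "w \<in> UNIV \<rightarrow> g ` S" by (simp add: B_def)
    have "k \<circ> w \<in> UNIV \<rightarrow> carrier A" using w kS S by fastforce
    moreover have "satisfies A d" using A d unfolding models_def by blast
    ultimately have "eval A (k \<circ> w) (fst d) = eval A (k \<circ> w) (snd d)"
      unfolding satisfies_def by blast
    moreover have "fst d \<in> trms F" "snd d \<in> trms F" using d E by auto
    ultimately show "eval B w (fst d) = eval B w (snd d)" using ev[OF w] by simp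
  qed
  moreover have "\<not> satisfies B e"
  proof
    assume sat: "satisfies B e"
    have w: "g \<circ> v \<in> UNIV \<rightarrow> g ` S" using vS by auto
    have kv: "k \<circ> (g \<circ> v) = v" using kg vS by auto
    have t: "fst e \<in> trms F" "snd e \<in> trms F" using e(1) by auto
    have "eval B (g \<circ> v) (fst e) = eval B (g \<circ> v) (snd e)"
      using sat w unfolding satisfies_def B_def by auto
    then have "g (eval A v (fst e)) = g (eval A v (snd e))"
      using ev[OF w] t unfolding kv by simp
    moreover have "eval A v (fst e) \<in> S" "eval A v (snd e) \<in> S" unfolding S_def using t by auto
    ultimately show False using g v(2) by (auto dest: inj_onD)
  qed
  ultimately show ?thesis using algB unfolding models_def by blast
qed

definition subvarieties :: "opsym set \<Rightarrow> 'a alg set \<Rightarrow> 'a alg set gorder" where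
  "subvarieties F V = \<lparr>carrier = {K. variety F K \<and> K \<subseteq> V}, eq = (=), le = (\<subseteq>)\<rparr>"

definition lattice_isomorphic ::
  "('a, 'c) gorder_scheme \<Rightarrow> ('b, 'd) gorder_scheme \<Rightarrow> bool" where
  "lattice_isomorphic L M \<longleftrightarrow> lattice L \<and> lattice M \<and>
     (\<exists>h. bij_betw h (carrier L) (carrier M) \<and>
          (\<forall>x \<in> carrier L. \<forall>y \<in> carrier L.
             h (x \<squnion>\<^bsub>L\<^esub> y) = h x \<squnion>\<^bsub>M\<^esub> h y \<and> h (x \<sqinter>\<^bsub>L\<^esub> y) = h x \<sqinter>\<^bsub>M\<^esub> h y))"


section \<open>Algebras with a bounded distributive lattice reduct\<close>

abbreviation joinA :: "'a alg \<Rightarrow> 'a \<Rightarrow> 'a \<Rightarrow> 'a" where "joinA A x y \<equiv> interp A Join [x, y]"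
abbreviation meetA :: "'a alg \<Rightarrow> 'a \<Rightarrow> 'a \<Rightarrow> 'a" where "meetA A x y \<equiv> interp A Meet [x, y]"
abbreviation zeroA :: "'a alg \<Rightarrow> 'a" where "zeroA A \<equiv> interp A Zero []"
abbreviation oneA :: "'a alg \<Rightarrow> 'a" where "oneA A \<equiv> interp A One []"
abbreviation starA :: "'a alg \<Rightarrow> 'a \<Rightarrow> 'a" where "starA A x \<equiv> interp A Star [x]"
abbreviation plusA :: "'a alg \<Rightarrow> 'a \<Rightarrow> 'a" where "plusA A x \<equiv> interp A Plus [x]"
abbreviation impA :: "'a alg \<Rightarrow> 'a \<Rightarrow> 'a \<Rightarrow> 'a" where "impA A x y \<equiv> interp A Imp [x, y]"
abbreviation coimpA :: "'a alg \<Rightarrow> 'a \<Rightarrow> 'a \<Rightarrow> 'a" where "coimpA A x y \<equiv> interp A Coimp [x, y]"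

definition bounded_distrib_lattice_reduct :: "'a alg \<Rightarrow> bool" where
  "bounded_distrib_lattice_reduct A \<longleftrightarrow>
     (\<forall>x \<in> carrier A. \<forall>y \<in> carrier A. \<forall>z \<in> carrier A.
        joinA A (joinA A x y) z = joinA A x (joinA A y z) \<and>
        meetA A (meetA A x y) z = meetA A x (meetA A y z) \<and>
        joinA A x y = joinA A y x \<and>
        meetA A x y = meetA A y x \<and>
        joinA A x (meetA A x y) = x \<and>
        meetA A x (joinA A x y) = x \<and>
        meetA A x (joinA A y z) = joinA A (meetA A x y) (meetA A x z) \<and>
        joinA A x (zeroA A) = x \<and>
        meetA A x (oneA A) = x)"

definition lattice_order :: "'a alg \<Rightarrow> 'a gorder" where
  "lattice_order A = \<lparr>carrier = carrier A, eq = (=), le = (\<lambda>x y. meetA A x y = x)\<rparr>"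

definition pseudocomplement :: "'a alg \<Rightarrow> ('a \<Rightarrow> 'a) \<Rightarrow> bool" where
  "pseudocomplement A s \<longleftrightarrow> (\<forall>x \<in> carrier A.
     greatest (lattice_order A) (s x) {z \<in> carrier A. meetA A x z = zeroA A})"

definition dual_pseudocomplement :: "'a alg \<Rightarrow> ('a \<Rightarrow> 'a) \<Rightarrow> bool" where
  "dual_pseudocomplement A p \<longleftrightarrow> (\<forall>x \<in> carrier A.
     least (lattice_order A) (p x) {z \<in> carrier A. joinA A x z = oneA A})"

definition heyting_implication :: "'a alg \<Rightarrow> ('a \<Rightarrow> 'a \<Rightarrow> 'a) \<Rightarrow> bool" where
  "heyting_implication A i \<longleftrightarrow> (\<forall>x \<in> carrier A. \<forall>y \<in> carrier A.
     greatest (lattice_order A) (i x y)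
       {z \<in> carrier A. meetA A x z \<sqsubseteq>\<^bsub>lattice_order A\<^esub> y})"

text \<open>The arguments of \<open>\<leftarrow>\<close> are often written the other way round; here \<open>x \<leftarrow> y\<close> is the least \<open>z\<close>
  with \<open>y \<le> x \<or> z\<close>, so that \<open>x\<^sup>+ = x \<leftarrow> 1\<close>.\<close>

definition dual_heyting_implication :: "'a alg \<Rightarrow> ('a \<Rightarrow> 'a \<Rightarrow> 'a) \<Rightarrow> bool" where
  "dual_heyting_implication A c \<longleftrightarrow> (\<forall>x \<in> carrier A. \<forall>y \<in> carrier A.
     least (lattice_order A) (c x y)
       {z \<in> carrier A. y \<sqsubseteq>\<^bsub>lattice_order A\<^esub> joinA A x z})"

text \<open>The regularity identity (M), where \<open>s\<close> and \<open>p\<close> are the basic or derived operations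
  \<open>x\<^sup>*\<close> and \<open>x\<^sup>+\<close>.\<close>

definition regular :: "'a alg \<Rightarrow> ('a \<Rightarrow> 'a) \<Rightarrow> ('a \<Rightarrow> 'a) \<Rightarrow> bool" where
  "regular A s p \<longleftrightarrow> (\<forall>x \<in> carrier A. \<forall>y \<in> carrier A.
     joinA A (meetA A x (p x)) (joinA A y (s y)) = joinA A y (s y))"

definition "sig_DBLP = {Join, Meet, Star, Plus, Zero, One}"
definition "sig_DPCH = {Join, Meet, Imp, Plus, Zero, One}"
definition "sig_PCHd = {Join, Meet, Star, Coimp, Zero, One}"
definition "sig_DBLH = {Join, Meet, Imp, Coimp, Zero, One}"

definition RDBLP :: "'a alg set" where
  "RDBLP = {A. is_algebra sig_DBLP A \<and> bounded_distrib_lattice_reduct A \<and>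
     pseudocomplement A (starA A) \<and> dual_pseudocomplement A (plusA A) \<and>
     regular A (starA A) (plusA A)}"

definition RDPCH :: "'a alg set" where
  "RDPCH = {A. is_algebra sig_DPCH A \<and> bounded_distrib_lattice_reduct A \<and>
     heyting_implication A (impA A) \<and> dual_pseudocomplement A (plusA A) \<and>
     regular A (\<lambda>x. impA A x (zeroA A)) (plusA A)}"

definition RPCHd :: "'a alg set" where
  "RPCHd = {A. is_algebra sig_PCHd A \<and> bounded_distrib_lattice_reduct A \<and>
     pseudocomplement A (starA A) \<and> dual_heyting_implication A (coimpA A) \<and>
     regular A (starA A) (\<lambda>x. coimpA A x (oneA A))}"

definition RDBLH :: "'a alg set" where
  "RDBLH = {A. is_algebra sig_DBLH A \<and> bounded_distrib_lattice_reduct A \<and>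
     heyting_implication A (impA A) \<and> dual_heyting_implication A (coimpA A) \<and>
     regular A (\<lambda>x. impA A x (zeroA A)) (\<lambda>x. coimpA A x (oneA A))}"

end

(* The four classes are term equivalent: in a regular double p-algebra the relative pseudocomplement
   of x and y is (x /\ y^* )^* /\ ((x \/ x^* )^+ \/ x^* \/ y), and since (M) is self-dual, the dual
   term gives the dual relative pseudocomplement.  Conversely x^* and x^+ are x -> 0 and x <- 1.
   A term equivalence with a variety carries equational classes to equational classes in both
   directions, hence is an inclusion-preserving bijection between subvarieties. *)

theory Submission
  imports Defs
begin

section \<open>Lattices of subvarieties\<close>

text \<open>Translated into the other signature, the identities of a subvariety constrain only the
  derived algebra; they do not say how the given operations relate to it. This is why the image of a
  variety gets one additional identity per operation symbol, equating the operation with its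
  translation there and back. With these identities the target class is automatically a variety, so
  an explicit equational basis has to be found for one class only, the regular double p-algebras,
  where "largest" and "least" must be replaced by equations. The round trips return the original
  algebra because implications and pseudocomplements are determined by the order: an operation and a
  term with the same universal property coincide. Algebras are extensional records, so this is an
  equality and not just an isomorphism. The other three classes are compared with this one by a
  single argument parametrized by the signature.\<close>

lemma lattice_isomorphicI:
  assumes "lattice L" "lattice M" and bij: "bij_betw h (carrier L) (carrier M)"
    and mono: "\<And>x y. x \<in> carrier L \<Longrightarrow> y \<in> carrier L \<Longrightarrow> le L x y \<longleftrightarrow> le M (h x) (h y)"
  shows "lattice_isomorphic L M"
proof -
  interpret L: lattice L by fact
  interpret M: lattice M by fact
  have hM: "h x \<in> carrier M" if "x \<in> carrier L" for x
    using bij that by (auto dest: bij_betwE)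
  have onto: "\<exists>x \<in> carrier L. h x = y" if "y \<in> carrier M" for y
    using bij_betw_imp_surj_on[OF bij] that by (metis imageE)
  have "h (join L x y) = join M (h x) (h y)" if xy: "x \<in> carrier L" "y \<in> carrier L" for x y
  proof -
    \<comment> \<open>By surjectivity the join in \<open>M\<close> is itself an image; its preimage
      can then be compared with \<open>join L x y\<close> by reflecting the order.\<close>
    obtain u where u: "u \<in> carrier L" "h u = join M (h x) (h y)"
      using onto[of "join M (h x) (h y)"] hM xy by auto
    have "le M (h x) (h u)" "le M (h y) (h u)"
      unfolding u(2) using hM xy by (auto intro: M.join_left M.join_right)
    then have "le L (join L x y) u"
      using mono xy u(1) by (intro L.join_le) simp_all
    then have "le M (h (join L x y)) (join M (h x) (h y))"
      using mono xy u L.join_closed by metis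
    moreover have "le M (join M (h x) (h y)) (h (join L x y))"
      using xy hM by (intro M.join_le) (simp_all add: L.join_left L.join_right flip: mono)
    ultimately show ?thesis
      using M.le_antisym hM xy M.join_closed L.join_closed by auto
  qed
  moreover have "h (meet L x y) = meet M (h x) (h y)"
    if xy: "x \<in> carrier L" "y \<in> carrier L" for x y
  proof -
    obtain u where u: "u \<in> carrier L" "h u = meet M (h x) (h y)"
      using onto[of "meet M (h x) (h y)"] hM xy by auto
    have "le M (h u) (h x)" "le M (h u) (h y)"
      unfolding u(2) using hM xy by (auto intro: M.meet_left M.meet_right)
    then have "le L u (meet L x y)"
      using mono xy u(1) by (intro L.meet_le) simp_all
    then have "le M (meet M (h x) (h y)) (h (meet L x y))"
      using mono xy u L.meet_closed by metis
    moreover have "le M (h (meet L x y)) (meet M (h x) (h y))"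
      using xy hM by (intro M.meet_le) (simp_all add: L.meet_left L.meet_right flip: mono)
    ultimately show ?thesis
      using M.le_antisym hM xy M.meet_closed L.meet_closed by auto
  qed
  ultimately show ?thesis
    unfolding lattice_isomorphic_def using assms by blast
qed

lemma lattice_isomorphic_sym:
  assumes "lattice_isomorphic L M"
  shows "lattice_isomorphic M L"
proof -
  obtain h where h: "lattice L" "lattice M" "bij_betw h (carrier L) (carrier M)"
    "\<And>x y. x \<in> carrier L \<Longrightarrow> y \<in> carrier L \<Longrightarrow>
       h (join L x y) = join M (h x) (h y) \<and> h (meet L x y) = meet M (h x) (h y)"
    using assms unfolding lattice_isomorphic_def by blast
  interpret L: lattice L by fact
  define g where "g = inv_into (carrier L) h"
  have g: "bij_betw g (carrier M) (carrier L)"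
    unfolding g_def using h(3) by (rule bij_betw_inv_into)
  have gL: "g x \<in> carrier L" if "x \<in> carrier M" for x using g that by (auto dest: bij_betwE)
  have hg: "h (g x) = x" if "x \<in> carrier M" for x
    unfolding g_def using h(3) that by (rule bij_betw_inv_into_right)
  have gh: "g (h x) = x" if "x \<in> carrier L" for x
    unfolding g_def using h(3) that by (rule bij_betw_inv_into_left)
  have "g (join M x y) = join L (g x) (g y) \<and> g (meet M x y) = meet L (g x) (g y)"
    if xy: "x \<in> carrier M" "y \<in> carrier M" for x y
  proof -
    have "g (h (join L (g x) (g y))) = join L (g x) (g y)"
      "g (h (meet L (g x) (g y))) = meet L (g x) (g y)"
      using gL xy by (auto intro!: gh)
    then show ?thesis using h(4)[of "g x" "g y"] gL xy hg by simp
  qed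
  then show ?thesis using h g unfolding lattice_isomorphic_def by blast
qed

lemma lattice_isomorphic_trans:
  assumes "lattice_isomorphic L M" "lattice_isomorphic M N"
  shows "lattice_isomorphic L N"
proof -
  obtain h where h: "lattice L" "lattice M" "bij_betw h (carrier L) (carrier M)"
    "\<And>x y. x \<in> carrier L \<Longrightarrow> y \<in> carrier L \<Longrightarrow>
       h (join L x y) = join M (h x) (h y) \<and> h (meet L x y) = meet M (h x) (h y)"
    using assms(1) unfolding lattice_isomorphic_def by blast
  obtain g where g: "lattice N" "bij_betw g (carrier M) (carrier N)"
    "\<And>x y. x \<in> carrier M \<Longrightarrow> y \<in> carrier M \<Longrightarrow>
       g (join M x y) = join N (g x) (g y) \<and> g (meet M x y) = meet N (g x) (g y)"
    using assms(2) unfolding lattice_isomorphic_def by blast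
  have "h x \<in> carrier M" if "x \<in> carrier L" for x using h(3) that by (auto dest: bij_betwE)
  then have "\<forall>x \<in> carrier L. \<forall>y \<in> carrier L.
      (g \<circ> h) (join L x y) = join N ((g \<circ> h) x) ((g \<circ> h) y) \<and>
      (g \<circ> h) (meet L x y) = meet N ((g \<circ> h) x) ((g \<circ> h) y)"
    using h(4) g(3) by simp
  then show ?thesis
    unfolding lattice_isomorphic_def using h g bij_betw_trans[OF h(3) g(2)] by blast
qed

text \<open>The union of two varieties is in general not a variety, so the join is the class defined
  by the identities common to both; the meet is the intersection, defined by the union of the
  axioms.\<close>

lemma lattice_subvarieties:
  assumes V: "variety F V"
  shows "lattice (subvarieties F V)"
proof -
  interpret partial_order "subvarieties F V"
    by unfold_locales (auto simp: subvarieties_def)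
  obtain EV where EV: "EV \<subseteq> trms F \<times> trms F" "V = models F EV"
    using V unfolding variety_def by blast
  show ?thesis
  proof unfold_locales
    fix K1 K2 assume K: "K1 \<in> carrier (subvarieties F V)" "K2 \<in> carrier (subvarieties F V)"
    define E where "E = {e \<in> trms F \<times> trms F. \<forall>A \<in> K1 \<union> K2. satisfies A e}"
    \<comment> \<open>The axioms of \<open>V\<close> are among the common identities, which keeps
      the join inside \<open>V\<close>.\<close>
    have "\<forall>e \<in> EV. \<forall>A \<in> K1 \<union> K2. satisfies A e"
      using EV(2) K unfolding subvarieties_def models_def by auto
    then have "EV \<subseteq> E" using EV(1) unfolding E_def by blast
    then have "models F E \<subseteq> V" unfolding EV(2) models_def by blast
    moreover have "variety F (models F E)"
      unfolding variety_def by (rule exI[of _ E]) (auto simp: E_def)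
    moreover have "K1 \<subseteq> models F E" "K2 \<subseteq> models F E"
    proof -
      have "\<forall>A \<in> K1 \<union> K2. is_algebra F A"
        using K EV(2) unfolding subvarieties_def models_def by auto
      then show "K1 \<subseteq> models F E" "K2 \<subseteq> models F E"
        unfolding E_def models_def by blast+
    qed
    moreover have "models F E \<subseteq> K" if "variety F K" "K1 \<subseteq> K" "K2 \<subseteq> K" for K
    proof -
      obtain E' where E': "E' \<subseteq> trms F \<times> trms F" "K = models F E'"
        using \<open>variety F K\<close> unfolding variety_def by blast
      \<comment> \<open>An upper bound is defined by identities true in both classes, and all of
        these belong to \<open>E\<close>.\<close>
      then have "E' \<subseteq> E" using that(2,3) unfolding E_def models_def by blast
      then show ?thesis unfolding E'(2) models_def by blast
    qed
    ultimately have "least (subvarieties F V) (models F E) (Upper (subvarieties F V) {K1, K2})"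
      using K by (auto simp: least_def Upper_def subvarieties_def)
    then show "\<exists>s. least (subvarieties F V) s (Upper (subvarieties F V) {K1, K2})" ..
  next
    fix K1 K2 assume K: "K1 \<in> carrier (subvarieties F V)" "K2 \<in> carrier (subvarieties F V)"
    then obtain E1 E2 where E: "E1 \<subseteq> trms F \<times> trms F" "K1 = models F E1"
      "E2 \<subseteq> trms F \<times> trms F" "K2 = models F E2"
      unfolding subvarieties_def variety_def by auto
    then have "K1 \<inter> K2 = models F (E1 \<union> E2)" unfolding models_def by auto
    then have "variety F (K1 \<inter> K2)"
      unfolding variety_def using E by (intro exI[of _ "E1 \<union> E2"]) simp
    then have "greatest (subvarieties F V) (K1 \<inter> K2) (Lower (subvarieties F V) {K1, K2})"
      using K by (auto simp: greatest_def Lower_def subvarieties_def)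
    then show "\<exists>s. greatest (subvarieties F V) s (Lower (subvarieties F V) {K1, K2})" ..
  qed
qed


section \<open>Term equivalence\<close>

primrec vars :: "trm \<Rightarrow> nat set" where
  "vars (Var n) = {n}"
| "vars (App f ts) = \<Union>(set (map vars ts))"

primrec subst_trm :: "(nat \<Rightarrow> trm) \<Rightarrow> trm \<Rightarrow> trm" where
  "subst_trm \<tau> (Var n) = \<tau> n"
| "subst_trm \<tau> (App f ts) = App f (map (subst_trm \<tau>) ts)"

text \<open>\<open>\<sigma> f\<close> is a defining term in which variable \<open>i\<close> stands
  for argument number \<open>i\<close>; the substitution is therefore \<open>nth\<close> of the
  translated argument list.\<close>

primrec translate :: "(opsym \<Rightarrow> trm) \<Rightarrow> trm \<Rightarrow> trm" where
  "translate \<sigma> (Var n) = Var n"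
| "translate \<sigma> (App f ts) = subst_trm (nth (map (translate \<sigma>) ts)) (\<sigma> f)"

definition basic :: "opsym \<Rightarrow> trm" where
  "basic f = App f (map Var [0..<arity f])"

text \<open>The bound on the variables makes \<open>\<sigma> f\<close> define an operation of the
  right arity. It also keeps evaluation away from positions beyond the argument list, where
  \<open>nth\<close> is unspecified.\<close>

definition interpretation_of :: "opsym set \<Rightarrow> opsym set \<Rightarrow> (opsym \<Rightarrow> trm) \<Rightarrow> bool" where
  "interpretation_of G F \<sigma> \<longleftrightarrow> (\<forall>f \<in> G. \<sigma> f \<in> trms F \<and> vars (\<sigma> f) \<subseteq> {..<arity f})"

text \<open>The restrictions match the extensional function spaces in \<open>is_algebra\<close>, so
  that passing back and forth can return literally the same algebra.\<close>

definition derived :: "opsym set \<Rightarrow> (opsym \<Rightarrow> trm) \<Rightarrow> 'a alg \<Rightarrow> 'a alg" where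
  "derived G \<sigma> A = \<lparr>carrier = carrier A,
     interp = (\<lambda>f\<in>G. \<lambda>xs\<in>tuples A (arity f). eval A (nth xs) (\<sigma> f))\<rparr>"

lemma carrier_derived [simp]: "carrier (derived G \<sigma> A) = carrier A"
  by (simp add: derived_def)

lemma interp_derived:
  "f \<in> G \<Longrightarrow> xs \<in> tuples A (arity f) \<Longrightarrow>
     interp (derived G \<sigma> A) f xs = eval A (nth xs) (\<sigma> f)"
  by (simp add: derived_def)

lemma eval_cong_vars:
  "(\<And>n. n \<in> vars t \<Longrightarrow> v n = w n) \<Longrightarrow> eval A v t = eval A w t"
proof (induction t)
  case (App f ts)
  have "map (eval A v) ts = map (eval A w) ts"
    using App by (auto intro!: App.IH)
  then show ?case by (simp only: eval.simps)
qed simp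

lemma eval_subst_trm: "eval A v (subst_trm \<tau> t) = eval A (\<lambda>n. eval A v (\<tau> n)) t"
  by (induction t) (simp_all add: comp_def cong: map_cong)

lemma subst_trm_in_trms:
  "t \<in> trms F \<Longrightarrow> (\<And>n. n \<in> vars t \<Longrightarrow> \<tau> n \<in> trms F) \<Longrightarrow> subst_trm \<tau> t \<in> trms F"
proof (induction rule: trms.induct)
  case (App f ts)
  have "subst_trm \<tau> t \<in> trms F" if "t \<in> set ts" for t
    using App(3,4) that by fastforce
  then show ?case using App(1,2) by (auto intro!: trms.App)
qed simp

lemma basic_in_trms: "f \<in> F \<Longrightarrow> basic f \<in> trms F"
  unfolding basic_def by (auto intro!: trms.intros)

lemma eval_basic: "length xs = arity f \<Longrightarrow> eval A (nth xs) (basic f) = interp A f xs"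
proof -
  assume "length xs = arity f"
  then have "map (eval A (nth xs)) (map Var [0..<arity f]) = xs"
    by (auto intro!: nth_equalityI)
  then show ?thesis unfolding basic_def by (simp only: eval.simps)
qed

lemma interp_closed:
  assumes "is_algebra F A" "f \<in> F" "xs \<in> tuples A (arity f)"
  shows "interp A f xs \<in> carrier A"
proof -
  have "interp A f \<in> tuples A (arity f) \<rightarrow>\<^sub>E carrier A"
    using assms unfolding is_algebra_def by (auto dest: PiE_mem)
  then show ?thesis using assms by (auto dest: PiE_mem)
qed

text \<open>Unlike \<open>eval_closed\<close>, this asks nothing of variables that do not occur,
  because it is applied to valuations \<open>nth xs\<close>, which are unspecified beyond the end of
  \<open>xs\<close>.\<close>

lemma eval_closed_vars:
  assumes "is_algebra F A" "t \<in> trms F" "\<And>n. n \<in> vars t \<Longrightarrow> v n \<in> carrier A"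
  shows "eval A v t \<in> carrier A"
  using assms(2,3)
proof induction
  case (App f ts)
  then have "map (eval A v) ts \<in> tuples A (arity f)"
    unfolding tuples_def by auto
  then show ?case using interp_closed[OF assms(1) App(1)] by simp
qed auto

lemma algebra_eqI:
  fixes A B :: "'a alg"
  assumes "is_algebra F A" "is_algebra F B" "carrier A = carrier B"
    and "\<And>f xs. f \<in> F \<Longrightarrow> xs \<in> tuples A (arity f) \<Longrightarrow> interp A f xs = interp B f xs"
  shows "A = B"
proof -
  have tup: "tuples A = tuples B" using assms(3) by (auto simp: tuples_def fun_eq_iff)
  have "interp A f = interp B f" if "f \<in> F" for f
  proof (rule PiE_ext)
    show "interp A f \<in> tuples A (arity f) \<rightarrow>\<^sub>E carrier A"
      "interp B f \<in> tuples A (arity f) \<rightarrow>\<^sub>E carrier A"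
      using assms(1,2,3) that unfolding is_algebra_def tup by (auto dest: PiE_mem)
  qed (use assms(4) that in auto)
  moreover have "interp A \<in> extensional F" "interp B \<in> extensional F"
    using assms(1,2) unfolding is_algebra_def PiE_def by blast+
  ultimately have "interp A = interp B" by (metis extensionalityI)
  then show ?thesis using assms(3) by (cases A; cases B) simp
qed

lemma is_algebra_derived:
  assumes "is_algebra F A" "interpretation_of G F \<sigma>"
  shows "is_algebra G (derived G \<sigma> A)"
  unfolding is_algebra_def
proof (intro conjI PiE_I)
  show "carrier (derived G \<sigma> A) \<noteq> {}" using assms(1) by (simp add: is_algebra_def)
  fix f xs assume f: "f \<in> G" and "xs \<in> tuples (derived G \<sigma> A) (arity f)"
  then have xs: "xs \<in> tuples A (arity f)" by (simp add: tuples_def)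
  have "eval A (nth xs) (\<sigma> f) \<in> carrier A"
    using assms f xs unfolding interpretation_of_def tuples_def
    by (intro eval_closed_vars[OF assms(1)]) (auto simp: subset_iff)
  then show "interp (derived G \<sigma> A) f xs \<in> carrier (derived G \<sigma> A)"
    using f xs by (simp add: interp_derived)
qed (auto simp: derived_def tuples_def)

lemma translate_in_trms:
  assumes "interpretation_of G F \<sigma>" "t \<in> trms G"
  shows "translate \<sigma> t \<in> trms F"
  using assms(2)
proof induction
  case (App f ts)
  have "\<sigma> f \<in> trms F" "vars (\<sigma> f) \<subseteq> {..<arity f}"
    using assms(1) App(1) unfolding interpretation_of_def by auto
  then show ?case using App by (auto intro!: subst_trm_in_trms simp: subset_iff)
qed (simp add: trms.Var)

text \<open>Evaluation in the derived algebra unfolds every operation into its defining term, and a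
  substitution is evaluated by changing the valuation.\<close>

lemma eval_derived:
  assumes "is_algebra F A" "interpretation_of G F \<sigma>" "t \<in> trms G"
    and v: "\<And>n. n \<in> vars t \<Longrightarrow> v n \<in> carrier A"
  shows "eval (derived G \<sigma> A) v t = eval A v (translate \<sigma> t)"
  using assms(3) v
proof induction
  case (App f ts)
  let ?xs = "map (eval A v) (map (translate \<sigma>) ts)"
  have eq: "map (eval (derived G \<sigma> A) v) ts = ?xs"
    using App by (auto simp: comp_def)
  \<comment> \<open>The derived operation agrees with its defining term only on tuples from the
    carrier, so the argument values must be shown to lie there.\<close>
  have "eval (derived G \<sigma> A) v t \<in> carrier A" if "t \<in> set ts" for t
  proof -
    have "v n \<in> carrier (derived G \<sigma> A)" if "n \<in> vars t" for n
      using App(4) that \<open>t \<in> set ts\<close> by auto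
    then show ?thesis
      using eval_closed_vars[OF is_algebra_derived[OF assms(1,2)]] App(3) that by fastforce
  qed
  then have "?xs \<in> tuples A (arity f)"
    unfolding eq[symmetric] tuples_def using App by auto
  then have "eval (derived G \<sigma> A) v (App f ts) = eval A (nth ?xs) (\<sigma> f)"
    unfolding eval.simps eq using App(1) by (intro interp_derived)
  also have "\<dots> = eval A v (translate \<sigma> (App f ts))"
    unfolding translate.simps eval_subst_trm using assms(2) App(1,2)
    by (intro eval_cong_vars) (auto simp: interpretation_of_def subset_iff)
  finally show ?case .
qed simp

lemma satisfies_derived:
  assumes "is_algebra F A" "interpretation_of G F \<sigma>" "e \<in> trms G \<times> trms G"
  shows "satisfies (derived G \<sigma> A) e \<longleftrightarrow> satisfies A (map_prod (translate \<sigma>) (translate \<sigma>) e)"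
proof -
  have "eval (derived G \<sigma> A) v t = eval A v (translate \<sigma> t)"
    if "t \<in> trms G" "v \<in> UNIV \<rightarrow> carrier A" for v t
    using that by (intro eval_derived[OF assms(1,2)]) auto
  then show ?thesis
    using assms(3) unfolding satisfies_def by (auto simp: Pi_def)
qed

lemma satisfies_basic_iff:
  fixes A :: "'a alg"
  assumes "is_algebra F A" "f \<in> F" "vars t \<subseteq> {..<arity f}"
  shows "satisfies A (basic f, t) \<longleftrightarrow>
    (\<forall>xs \<in> tuples A (arity f). interp A f xs = eval A (nth xs) t)"
proof
  assume sat: "satisfies A (basic f, t)"
  obtain c where c: "c \<in> carrier A" using assms(1) unfolding is_algebra_def by auto
  show "\<forall>xs \<in> tuples A (arity f). interp A f xs = eval A (nth xs) t"
  proof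
    fix xs assume xs: "xs \<in> tuples A (arity f)"
    \<comment> \<open>Satisfaction quantifies over total valuations, so the tuple is continued by an
      arbitrary carrier element \<open>c\<close>. Its existence comes from nonemptiness, which
      matters when \<open>f\<close> is a constant.\<close>
    define v where "v = (\<lambda>n. if n < arity f then xs ! n else c)"
    have "v \<in> UNIV \<rightarrow> carrier A" using xs c unfolding v_def tuples_def by (auto simp: subset_iff)
    then have "eval A v (basic f) = eval A v t" using sat unfolding satisfies_def by auto
    moreover have "eval A v (basic f) = eval A (nth xs) (basic f)"
      by (rule eval_cong_vars) (auto simp: v_def basic_def)
    moreover have "eval A v t = eval A (nth xs) t"
      using assms(3) by (intro eval_cong_vars) (auto simp: v_def)
    ultimately show "interp A f xs = eval A (nth xs) t"
      using eval_basic xs unfolding tuples_def by force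
  qed
next
  assume eq: "\<forall>xs \<in> tuples A (arity f). interp A f xs = eval A (nth xs) t"
  show "satisfies A (basic f, t)"
    unfolding satisfies_def
  proof
    fix v :: "nat \<Rightarrow> 'a" assume v: "v \<in> UNIV \<rightarrow> carrier A"
    define xs where "xs = map v [0..<arity f]"
    have "xs \<in> tuples A (arity f)" using v unfolding xs_def tuples_def by auto
    then have "interp A f xs = eval A (nth xs) t" using eq by blast
    moreover have "eval A (nth xs) t = eval A v t"
      using assms(3) by (intro eval_cong_vars) (auto simp: xs_def)
    moreover have "eval A v (basic f) = interp A f xs"
      by (simp add: basic_def xs_def comp_def)
    ultimately show "eval A v (fst (basic f, t)) = eval A v (snd (basic f, t))" by simp
  qed
qed

section \<open>Transport of varieties along a term equivalence\<close>

locale term_equivalence =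
  fixes F :: "opsym set" and V :: "'a alg set" and \<sigma> :: "opsym \<Rightarrow> trm"
    and G :: "opsym set" and W :: "'a alg set" and \<rho> :: "opsym \<Rightarrow> trm"
  assumes algV: "A \<in> V \<Longrightarrow> is_algebra F A"
    and algW: "B \<in> W \<Longrightarrow> is_algebra G B"
    and interp_\<sigma>: "interpretation_of G F \<sigma>"
    and interp_\<rho>: "interpretation_of F G \<rho>"
    and derivedV: "A \<in> V \<Longrightarrow> derived G \<sigma> A \<in> W"
    and derivedW: "B \<in> W \<Longrightarrow> derived F \<rho> B \<in> V"
    and roundV: "A \<in> V \<Longrightarrow> derived F \<rho> (derived G \<sigma> A) = A"
    and roundW: "B \<in> W \<Longrightarrow> derived G \<sigma> (derived F \<rho> B) = B"
begin

text \<open>The assumptions are symmetric in the two sides, so results about images under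
  \<open>derived G \<sigma>\<close> also hold for \<open>derived F \<rho>\<close>.\<close>

lemma converse: "term_equivalence G W \<rho> F V \<sigma>"
  by (rule term_equivalence.intro)
    (use algV algW interp_\<sigma> interp_\<rho> derivedV derivedW roundV roundW in auto)

text \<open>These identities single out the algebras of type \<open>G\<close> that can be
  reconstructed from their derived algebras of type \<open>F\<close>.\<close>

definition round_trip :: "(trm \<times> trm) set" where
  "round_trip = (\<lambda>f. (basic f, translate \<rho> (\<sigma> f))) ` G"

text \<open>Two algebras of one type on one carrier are equal once their operations agree on tuples,
  and agreement for a single symbol is a single identity.\<close>

lemma round_trip_iff:
  assumes B: "is_algebra G B"
  shows "derived G \<sigma> (derived F \<rho> B) = B \<longleftrightarrow> (\<forall>e \<in> round_trip. satisfies B e)"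
proof -
  have algF: "is_algebra F (derived F \<rho> B)" using is_algebra_derived[OF B interp_\<rho>] .
  have algG: "is_algebra G (derived G \<sigma> (derived F \<rho> B))"
    using is_algebra_derived[OF algF interp_\<sigma>] .
  \<comment> \<open>Translation must not introduce variables beyond the arity; otherwise the
    round-trip term would not depend on the arguments alone.\<close>
  have vars: "vars (translate \<rho> t) \<subseteq> {..<n}" if "t \<in> trms F" "vars t \<subseteq> {..<n}" for t n
    using that
  proof (induction t)
    case (App f ts)
    have "\<rho> f \<in> trms G" "vars (\<rho> f) \<subseteq> {..<arity f}"
      using interp_\<rho> App(1) unfolding interpretation_of_def by auto
    have sub: "vars (subst_trm \<tau> t) = (\<Union>n\<in>vars t. vars (\<tau> n))" for \<tau> t
      by (induction t) auto
    show ?case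
    proof
      fix m assume "m \<in> vars (translate \<rho> (App f ts))"
      then obtain i where i: "i < arity f" "m \<in> vars (map (translate \<rho>) ts ! i)"
        using \<open>vars (\<rho> f) \<subseteq> {..<arity f}\<close> by (auto simp: sub)
      moreover have "ts ! i \<in> set ts" using i(1) App(2) by auto
      moreover have "vars (ts ! i) \<subseteq> {..<n}" using \<open>ts ! i \<in> set ts\<close> App.prems by auto
      ultimately show "m \<in> {..<n}" using App(2,3) by auto
    qed
  qed auto
  have eq: "interp (derived G \<sigma> (derived F \<rho> B)) f xs = eval B (nth xs) (translate \<rho> (\<sigma> f))"
    if f: "f \<in> G" "xs \<in> tuples B (arity f)" for f xs
  proof -
    have "interp (derived G \<sigma> (derived F \<rho> B)) f xs = eval (derived F \<rho> B) (nth xs) (\<sigma> f)"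
      using f by (intro interp_derived) (auto simp: tuples_def)
    also have "\<dots> = eval B (nth xs) (translate \<rho> (\<sigma> f))"
      using interp_\<sigma> f unfolding interpretation_of_def
      by (intro eval_derived[OF B interp_\<rho>]) (auto simp: tuples_def subset_iff)
    finally show ?thesis .
  qed
  have "satisfies B (basic f, translate \<rho> (\<sigma> f)) \<longleftrightarrow>
      (\<forall>xs \<in> tuples B (arity f). interp (derived G \<sigma> (derived F \<rho> B)) f xs = interp B f xs)"
    if "f \<in> G" for f
    using interp_\<sigma> that unfolding interpretation_of_def
    by (subst satisfies_basic_iff[OF B that vars]) (auto simp: eq)
  then have "(\<forall>e \<in> round_trip. satisfies B e) \<longleftrightarrow>
      (\<forall>f \<in> G. \<forall>xs \<in> tuples B (arity f). interp (derived G \<sigma> (derived F \<rho> B)) f xs = interp B f xs)"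
    unfolding round_trip_def by simp
  moreover have "\<dots> \<longleftrightarrow> derived G \<sigma> (derived F \<rho> B) = B"
    using algebra_eqI[OF algG B] by (auto simp: tuples_def)
  ultimately show ?thesis by simp
qed

text \<open>The translated axioms of \<open>K\<close> say that the derived algebra of type
  \<open>F\<close> lies in \<open>K\<close>; the round-trip identities say that the given algebra is
  recovered from it. Together they axiomatise the image.\<close>

lemma variety_image:
  assumes "variety F K" "K \<subseteq> V"
  shows "variety G (derived G \<sigma> ` K)"
proof -
  obtain E where E: "E \<subseteq> trms F \<times> trms F" "K = models F E"
    using assms(1) unfolding variety_def by blast
  let ?E = "map_prod (translate \<rho>) (translate \<rho>) ` E \<union> round_trip"
  have "round_trip \<subseteq> trms G \<times> trms G"
    using interp_\<sigma> basic_in_trms translate_in_trms[OF interp_\<rho>]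
    unfolding round_trip_def interpretation_of_def by auto
  moreover have "map_prod (translate \<rho>) (translate \<rho>) ` E \<subseteq> trms G \<times> trms G"
    using E(1) translate_in_trms[OF interp_\<rho>] by auto
  moreover have "derived G \<sigma> ` K = models G ?E"
  proof -
    have "B \<in> derived G \<sigma> ` K \<longleftrightarrow>
        is_algebra G B \<and> derived F \<rho> B \<in> K \<and> derived G \<sigma> (derived F \<rho> B) = B" for B
    proof
      assume "B \<in> derived G \<sigma> ` K"
      then obtain A where A: "A \<in> K" "B = derived G \<sigma> A" by blast
      then have "A \<in> V" using assms(2) by blast
      then show "is_algebra G B \<and> derived F \<rho> B \<in> K \<and> derived G \<sigma> (derived F \<rho> B) = B"
        using A roundV derivedV algW by metis
    qed (metis image_eqI)
    moreover have "derived F \<rho> B \<in> K \<longleftrightarrow>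
        (\<forall>e \<in> map_prod (translate \<rho>) (translate \<rho>) ` E. satisfies B e)" if "is_algebra G B" for B
      using satisfies_derived[OF that interp_\<rho>] is_algebra_derived[OF that interp_\<rho>] E
      unfolding models_def by auto
    ultimately have "B \<in> derived G \<sigma> ` K \<longleftrightarrow> B \<in> models G ?E" for B
      using round_trip_iff[of B] unfolding models_def mem_Collect_eq ball_Un by metis
    then show ?thesis by blast
  qed
  ultimately have "?E \<subseteq> trms G \<times> trms G \<and> derived G \<sigma> ` K = models G ?E"
    by (simp only: Un_least)
  then show ?thesis unfolding variety_def by (rule exI)
qed

theorem lattice_isomorphic_subvarieties:
  assumes V: "variety F V"
  shows "lattice_isomorphic (subvarieties F V) (subvarieties G W)"
proof -
  interpret conv: term_equivalence G W \<rho> F V \<sigma> by (rule converse)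
  \<comment> \<open>\<open>W\<close> is the full image of \<open>V\<close>, so that it is a variety
    is the case \<open>K = V\<close> of \<open>variety_image\<close>.\<close>
  have WV: "derived G \<sigma> ` V = W" using derivedV derivedW roundW by force
  then have W: "variety G W" using variety_image[OF V] by simp
  have \<rho>\<sigma>: "derived F \<rho> ` derived G \<sigma> ` K = K" if "K \<subseteq> V" for K
  proof -
    have "\<And>A. A \<in> K \<Longrightarrow> derived F \<rho> (derived G \<sigma> A) = A" using that roundV by blast
    then show ?thesis by force
  qed
  have \<sigma>\<rho>: "derived G \<sigma> ` derived F \<rho> ` K = K" if "K \<subseteq> W" for K
  proof -
    have "\<And>A. A \<in> K \<Longrightarrow> derived G \<sigma> (derived F \<rho> A) = A" using that roundW by blast
    then show ?thesis by force
  qed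
  have "bij_betw ((`) (derived G \<sigma>)) (carrier (subvarieties F V)) (carrier (subvarieties G W))"
    by (rule bij_betw_byWitness[where f' = "(`) (derived F \<rho>)"])
      (auto simp: subvarieties_def \<rho>\<sigma> \<sigma>\<rho> intro: variety_image conv.variety_image
        derivedV derivedW dest: subsetD)
  moreover have "K \<subseteq> K' \<longleftrightarrow> derived G \<sigma> ` K \<subseteq> derived G \<sigma> ` K'" if "K \<subseteq> V" "K' \<subseteq> V" for K K'
    using \<rho>\<sigma> that by (metis image_mono)
  ultimately show ?thesis
    using lattice_subvarieties V W
    by (intro lattice_isomorphicI) (auto simp: subvarieties_def)
qed

end

section \<open>Regular double p-algebras\<close>

text \<open>The operations are parameters rather than record fields, so exchanging join with meet
  and 0 with 1 gives another instance of the locale, and a dual fact costs only an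
  instantiation.\<close>

locale bounded_distrib_lattice_on =
  fixes C :: "'a set" and jn (infixl "\<oplus>" 65) and mt (infixl "\<odot>" 70) and z u
  assumes closed: "x \<in> C \<Longrightarrow> y \<in> C \<Longrightarrow> x \<oplus> y \<in> C" "x \<in> C \<Longrightarrow> y \<in> C \<Longrightarrow> x \<odot> y \<in> C"
      "z \<in> C" "u \<in> C"
    and assoc: "x \<in> C \<Longrightarrow> y \<in> C \<Longrightarrow> w \<in> C \<Longrightarrow> (x \<oplus> y) \<oplus> w = x \<oplus> (y \<oplus> w)"
      "x \<in> C \<Longrightarrow> y \<in> C \<Longrightarrow> w \<in> C \<Longrightarrow> (x \<odot> y) \<odot> w = x \<odot> (y \<odot> w)"
    and comm: "x \<in> C \<Longrightarrow> y \<in> C \<Longrightarrow> x \<oplus> y = y \<oplus> x"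
      "x \<in> C \<Longrightarrow> y \<in> C \<Longrightarrow> x \<odot> y = y \<odot> x"
    and absorb: "x \<in> C \<Longrightarrow> y \<in> C \<Longrightarrow> x \<oplus> (x \<odot> y) = x"
      "x \<in> C \<Longrightarrow> y \<in> C \<Longrightarrow> x \<odot> (x \<oplus> y) = x"
    and distrib: "x \<in> C \<Longrightarrow> y \<in> C \<Longrightarrow> w \<in> C \<Longrightarrow> x \<odot> (y \<oplus> w) = (x \<odot> y) \<oplus> (x \<odot> w)"
    and neutral: "x \<in> C \<Longrightarrow> x \<oplus> z = x" "x \<in> C \<Longrightarrow> x \<odot> u = x"
begin

text \<open>Expanding the right side by the assumed law gives
  \<open>x \<oplus> (x \<odot> w \<oplus> y \<odot> w)\<close>, where absorption removes the middle
  term. This is what makes the locale self-dual.\<close>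

lemma dual_distrib:
  assumes "x \<in> C" "y \<in> C" "w \<in> C"
  shows "x \<oplus> (y \<odot> w) = (x \<oplus> y) \<odot> (x \<oplus> w)"
proof -
  have "(x \<oplus> y) \<odot> (x \<oplus> w) = (x \<oplus> y) \<odot> x \<oplus> (x \<oplus> y) \<odot> w"
    using assms by (intro distrib closed)
  also have "(x \<oplus> y) \<odot> x = x" using assms by (metis comm(2) absorb(2) closed(1))
  also have "(x \<oplus> y) \<odot> w = (x \<odot> w) \<oplus> (y \<odot> w)"
    using assms by (metis comm(2) distrib closed(1))
  also have "x \<oplus> ((x \<odot> w) \<oplus> (y \<odot> w)) = x \<oplus> (y \<odot> w)"
    using assms by (metis assoc(1) absorb(1) closed(2))
  finally show ?thesis ..
qed

lemma dual: "bounded_distrib_lattice_on C (\<odot>) (\<oplus>) u z"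
  by unfold_locales (simp_all add: closed assoc absorb neutral dual_distrib, simp_all add: comm)

definition below (infix "\<preceq>" 50) where "x \<preceq> y \<longleftrightarrow> x \<odot> y = x"

lemma below_iff_join: "x \<in> C \<Longrightarrow> y \<in> C \<Longrightarrow> x \<preceq> y \<longleftrightarrow> y \<oplus> x = y"
  unfolding below_def by (metis absorb comm)

lemma below_refl: "x \<in> C \<Longrightarrow> x \<preceq> x"
  unfolding below_def by (metis absorb closed(2))

lemma below_trans: "x \<preceq> y \<Longrightarrow> y \<preceq> w \<Longrightarrow> x \<in> C \<Longrightarrow> y \<in> C \<Longrightarrow> w \<in> C \<Longrightarrow> x \<preceq> w"
  unfolding below_def by (metis assoc(2))

lemma below_antisym: "x \<preceq> y \<Longrightarrow> y \<preceq> x \<Longrightarrow> x \<in> C \<Longrightarrow> y \<in> C \<Longrightarrow> x = y"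
  unfolding below_def by (metis comm(2))

text \<open>An element defined by a universal property is known through its lower set; this turns
  such a description into an equation.\<close>

lemma below_eqI:
  assumes "x \<in> C" "y \<in> C" "\<And>w. w \<in> C \<Longrightarrow> w \<preceq> x \<longleftrightarrow> w \<preceq> y"
  shows "x = y"
  using assms below_refl below_antisym by blast

lemma below_meet_iff:
  assumes "x \<in> C" "y \<in> C" "w \<in> C"
  shows "w \<preceq> x \<odot> y \<longleftrightarrow> w \<preceq> x \<and> w \<preceq> y"
proof -
  have "x \<odot> y \<preceq> x" "x \<odot> y \<preceq> y"
    using assms below_refl[of "x \<odot> y"] below_refl unfolding below_def by (metis assoc(2) comm(2) closed(2))+
  then show ?thesis
    using assms below_trans closed(2) unfolding below_def by (metis assoc(2))
qed

lemma join_below_iff: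
  assumes "x \<in> C" "y \<in> C" "w \<in> C"
  shows "x \<oplus> y \<preceq> w \<longleftrightarrow> x \<preceq> w \<and> y \<preceq> w"
proof
  assume "x \<oplus> y \<preceq> w"
  moreover have "x \<preceq> x \<oplus> y" "y \<preceq> x \<oplus> y"
    using assms absorb(2) comm(1) unfolding below_def by metis+
  ultimately show "x \<preceq> w \<and> y \<preceq> w" using assms below_trans closed(1) by blast
next
  assume "x \<preceq> w \<and> y \<preceq> w"
  then show "x \<oplus> y \<preceq> w"
    using assms closed(1) by (simp add: below_iff_join flip: assoc(1))
qed

lemma meet_below: "x \<in> C \<Longrightarrow> y \<in> C \<Longrightarrow> x \<odot> y \<preceq> x" "x \<in> C \<Longrightarrow> y \<in> C \<Longrightarrow> x \<odot> y \<preceq> y"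
  using below_meet_iff below_refl closed(2) by blast+

lemma below_join: "x \<in> C \<Longrightarrow> y \<in> C \<Longrightarrow> x \<preceq> x \<oplus> y" "x \<in> C \<Longrightarrow> y \<in> C \<Longrightarrow> y \<preceq> x \<oplus> y"
  using join_below_iff below_refl closed(1) by blast+

lemma meet_mono:
  "x \<preceq> x' \<Longrightarrow> y \<preceq> y' \<Longrightarrow> x \<in> C \<Longrightarrow> y \<in> C \<Longrightarrow> x' \<in> C \<Longrightarrow> y' \<in> C \<Longrightarrow> x \<odot> y \<preceq> x' \<odot> y'"
  using below_trans[OF meet_below(1)[of x y], of x'] below_trans[OF meet_below(2)[of x y], of y']
  by (simp add: below_meet_iff closed)

lemma zero_below: "x \<in> C \<Longrightarrow> z \<preceq> x"
  using below_iff_join closed(3) neutral(1) by simp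

lemma below_zero_iff: "x \<in> C \<Longrightarrow> x \<preceq> z \<longleftrightarrow> x = z"
  using below_antisym zero_below closed(3) by blast

lemma below_one: "x \<in> C \<Longrightarrow> x \<preceq> u"
  unfolding below_def by (rule neutral)

end

section \<open>Implication and its dual as terms of a regular double p-algebra\<close>

locale regular_double_p_on = bounded_distrib_lattice_on +
  fixes s p
  assumes sp_closed: "x \<in> C \<Longrightarrow> s x \<in> C" "x \<in> C \<Longrightarrow> p x \<in> C"
    and below_s_iff: "x \<in> C \<Longrightarrow> y \<in> C \<Longrightarrow> y \<preceq> s x \<longleftrightarrow> x \<odot> y = z"
    and p_below_iff: "x \<in> C \<Longrightarrow> y \<in> C \<Longrightarrow> p x \<preceq> y \<longleftrightarrow> x \<oplus> y = u"
    and reg: "x \<in> C \<Longrightarrow> y \<in> C \<Longrightarrow> x \<odot> p x \<preceq> y \<oplus> s y"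
begin

lemma dual_below:
  "bounded_distrib_lattice_on.below (\<oplus>) x y \<longleftrightarrow> y \<preceq> x" if "x \<in> C" "y \<in> C"
  using that below_iff_join bounded_distrib_lattice_on.below_def[OF dual] by simp

text \<open>Exchanging the lattice operations reverses the order and swaps the axioms of
  \<open>s\<close> and \<open>p\<close>; (M) turns into itself with \<open>x\<close> and
  \<open>y\<close> exchanged.\<close>

lemma dual_regular: "regular_double_p_on C (\<odot>) (\<oplus>) u z p s"
  by (intro regular_double_p_on.intro regular_double_p_on_axioms.intro dual)
    (use sp_closed below_s_iff p_below_iff reg closed dual_below in auto)

text \<open>A shortened form of Katrinak's term for relative pseudocomplements. Meeting \<open>x\<close> with the first
  factor gives something disjoint from \<open>s y\<close>; by regularity, \<open>x \<odot> p (x \<oplus> s x)\<close> lies below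
  \<open>y \<oplus> s y\<close>, so the meet of \<open>x\<close> with both factors is below \<open>y\<close>.\<close>

definition imp where "imp x y = s (x \<odot> s y) \<odot> (p (x \<oplus> s x) \<oplus> s x \<oplus> y)"

lemma imp_closed: "x \<in> C \<Longrightarrow> y \<in> C \<Longrightarrow> imp x y \<in> C"
  unfolding imp_def by (intro closed sp_closed)

lemma meet_s: "x \<in> C \<Longrightarrow> x \<odot> s x = z"
  using below_s_iff below_refl sp_closed by blast

lemma join_p: "x \<in> C \<Longrightarrow> x \<oplus> p x = u"
  using p_below_iff below_refl sp_closed by blast

text \<open>From right to left, \<open>w\<close> is split along
  \<open>x \<oplus> s x \<oplus> p (x \<oplus> s x) = u\<close>: its part in \<open>x\<close> is
  below \<open>y\<close> by assumption, and the other two parts are below joinands of the second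
  factor.\<close>

theorem below_imp_iff:
  assumes C: "x \<in> C" "y \<in> C" "w \<in> C"
  shows "w \<preceq> imp x y \<longleftrightarrow> x \<odot> w \<preceq> y"
proof -
  define a where "a = s (x \<odot> s y)"
  define b where "b = p (x \<oplus> s x)"
  note cl = closed sp_closed
  have ab: "a \<in> C" "b \<in> C" unfolding a_def b_def using C by (auto intro!: cl)
  have imp: "imp x y = a \<odot> (b \<oplus> s x \<oplus> y)" by (simp add: imp_def a_def b_def)
  have xa: "(x \<odot> a) \<odot> s y = z"
  proof -
    have "(x \<odot> s y) \<odot> a = z" unfolding a_def using C by (intro meet_s cl)
    then show ?thesis using C ab by (metis assoc(2) comm(2) sp_closed(1))
  qed
  have step: "x \<odot> imp x y \<preceq> y"
  proof -
    \<comment> \<open>Regularity is applied to \<open>x \<oplus> s x\<close>, since \<open>b\<close>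
      is the dual pseudocomplement of that join.\<close>
    have "x \<odot> b \<preceq> (x \<oplus> s x) \<odot> b"
      using C ab by (intro meet_mono below_join below_refl cl)
    moreover have "(x \<oplus> s x) \<odot> b \<preceq> y \<oplus> s y"
      unfolding b_def using C by (intro reg cl)
    ultimately have xb: "x \<odot> b \<preceq> y \<oplus> s y"
      using C ab below_trans[of "x \<odot> b" "(x \<oplus> s x) \<odot> b" "y \<oplus> s y"] by (simp add: cl)
    have "(x \<odot> a) \<odot> b \<preceq> (x \<odot> a) \<odot> (y \<oplus> s y)"
    proof -
      have "(x \<odot> a) \<odot> b \<preceq> x \<odot> b"
        using C ab by (intro meet_mono meet_below below_refl cl)
      then have "(x \<odot> a) \<odot> b \<preceq> y \<oplus> s y"
        using xb C ab below_trans[of "(x \<odot> a) \<odot> b" "x \<odot> b" "y \<oplus> s y"] by (simp add: cl)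
      then show ?thesis
        using C ab by (intro below_meet_iff[THEN iffD2] conjI meet_below cl)
    qed
    \<comment> \<open>By \<open>xa\<close> the joinand with \<open>s y\<close> vanishes, which
      leaves something below \<open>y\<close>.\<close>
    moreover have "(x \<odot> a) \<odot> (y \<oplus> s y) = (x \<odot> a) \<odot> y"
      using C ab xa by (simp add: distrib neutral cl)
    moreover have 3: "(x \<odot> a) \<odot> y \<preceq> y" using C ab by (intro meet_below cl)
    ultimately have 1: "(x \<odot> a) \<odot> b \<preceq> y"
      using C ab below_trans[of "(x \<odot> a) \<odot> b" "(x \<odot> a) \<odot> y" y] by (simp add: cl)
    have "(x \<odot> a) \<odot> s x = (x \<odot> s x) \<odot> a"
      using C ab by (metis assoc(2) comm(2) sp_closed(1))
    also have "\<dots> \<preceq> y"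
      using C ab below_trans[OF meet_below(1)[of z a] zero_below] by (simp add: meet_s cl)
    finally have 2: "(x \<odot> a) \<odot> s x \<preceq> y" .
    \<comment> \<open>The meet distributes over the three joinands of the second factor, each of
      which has been shown to contribute something below \<open>y\<close>.\<close>
    have "x \<odot> imp x y = (x \<odot> a) \<odot> b \<oplus> (x \<odot> a) \<odot> s x \<oplus> (x \<odot> a) \<odot> y"
      unfolding imp using C ab by (simp add: distrib cl flip: assoc(2))
    then show ?thesis using 1 2 3 C ab by (simp add: join_below_iff cl)
  qed
  show ?thesis
  proof
    assume "w \<preceq> imp x y"
    then have "x \<odot> w \<preceq> x \<odot> imp x y"
      using C by (intro meet_mono below_refl imp_closed)
    then show "x \<odot> w \<preceq> y"
      using step C below_trans[of "x \<odot> w" "x \<odot> imp x y" y] by (simp add: cl imp_closed)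
  next
    assume le: "x \<odot> w \<preceq> y"
    have "(x \<odot> s y) \<odot> w = (x \<odot> w) \<odot> s y"
      using C by (metis assoc(2) comm(2) sp_closed(1))
    also have "\<dots> \<preceq> y \<odot> s y" using le C by (intro meet_mono below_refl cl)
    finally have "w \<preceq> a"
      unfolding a_def using C by (simp add: below_s_iff meet_s below_zero_iff cl)
    moreover have "w \<preceq> b \<oplus> s x \<oplus> y"
    proof -
      have bC: "b \<oplus> s x \<oplus> y \<in> C" using C ab by (intro cl)
      have up: "b \<preceq> b \<oplus> s x \<oplus> y" "s x \<preceq> b \<oplus> s x \<oplus> y" "y \<preceq> b \<oplus> s x \<oplus> y"
        using below_refl[OF bC] C ab by (simp_all add: join_below_iff cl)
      have "w = w \<odot> ((x \<oplus> s x) \<oplus> b)"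
        unfolding b_def using C by (simp add: join_p neutral cl)
      also have "\<dots> = (x \<odot> w) \<oplus> w \<odot> s x \<oplus> w \<odot> b"
        using C ab by (simp add: distrib comm(2)[of w x] cl)
      also have "\<dots> \<preceq> b \<oplus> s x \<oplus> y"
      proof -
        have "x \<odot> w \<preceq> b \<oplus> s x \<oplus> y"
          using below_trans[OF le up(3)] C bC by (simp add: cl)
        moreover have "w \<odot> s x \<preceq> b \<oplus> s x \<oplus> y"
          using below_trans[OF meet_below(2) up(2)] C bC by (simp add: cl)
        moreover have "w \<odot> b \<preceq> b \<oplus> s x \<oplus> y"
          using below_trans[OF meet_below(2) up(1)] C bC ab by (simp add: cl)
        ultimately show ?thesis using C ab bC by (simp add: join_below_iff cl)
      qed
      finally show ?thesis .
    qed
    ultimately show "w \<preceq> imp x y"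
      unfolding imp using C ab by (simp add: below_meet_iff cl)
  qed
qed

text \<open>This is \<open>imp\<close> written out in the dual lattice with \<open>s\<close> and
  \<open>p\<close> exchanged, so that \<open>below_imp_iff\<close> transfers to it through
  \<open>dual_regular\<close>.\<close>

definition coimp where "coimp x y = p (x \<oplus> p y) \<oplus> (s (x \<odot> p x) \<odot> p x \<odot> y)"

lemma coimp_closed: "x \<in> C \<Longrightarrow> y \<in> C \<Longrightarrow> coimp x y \<in> C"
  unfolding coimp_def by (intro closed sp_closed)

theorem coimp_below_iff:
  assumes C: "x \<in> C" "y \<in> C" "w \<in> C"
  shows "coimp x y \<preceq> w \<longleftrightarrow> y \<preceq> x \<oplus> w"
  using regular_double_p_on.below_imp_iff[OF dual_regular C]
    dual_below[of w "coimp x y"] dual_below[of "x \<oplus> w" y] C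
  unfolding regular_double_p_on.imp_def[OF dual_regular] coimp_def[symmetric]
  by (simp add: coimp_closed closed)

end

section \<open>Pseudocomplements by equations\<close>

context bounded_distrib_lattice_on
begin

text \<open>Having a greatest solution of \<open>x \<odot> w \<preceq> y\<close> amounts to an
  adjunction because the solutions are closed downwards.\<close>

lemma relative_pseudocomplement_iff:
  assumes "x \<in> C" "y \<in> C" "i \<in> C"
  shows "x \<odot> i \<preceq> y \<and> (\<forall>w\<in>C. x \<odot> w \<preceq> y \<longrightarrow> w \<preceq> i) \<longleftrightarrow>
    (\<forall>w\<in>C. w \<preceq> i \<longleftrightarrow> x \<odot> w \<preceq> y)" (is "?L \<longleftrightarrow> ?R")
proof
  assume L: ?L
  have "x \<odot> w \<preceq> y" if "w \<in> C" "w \<preceq> i" for w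
    using L assms that meet_mono[of x x w i] below_trans[of "x \<odot> w" "x \<odot> i" y]
    by (simp add: below_refl closed)
  then show ?R using L by blast
next
  assume ?R
  then show ?L using assms below_refl by blast
qed

lemma pseudocomplement_at_iff:
  assumes "x \<in> C" "i \<in> C"
  shows "x \<odot> i = z \<and> (\<forall>w\<in>C. x \<odot> w = z \<longrightarrow> w \<preceq> i) \<longleftrightarrow> (\<forall>w\<in>C. w \<preceq> i \<longleftrightarrow> x \<odot> w = z)"
  using relative_pseudocomplement_iff[of x z i] assms by (simp add: below_zero_iff closed)

text \<open>Being the largest element disjoint from \<open>x\<close> is not an identity. The second
  law says that inside \<open>x\<close> the pseudocomplement of \<open>y\<close> depends only on
  \<open>x \<odot> y\<close>; combined with \<open>s z\<close> acting as a top element it yields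
  maximality.\<close>

lemma pseudocomplement_equations:
  assumes s: "\<And>x. x \<in> C \<Longrightarrow> s x \<in> C"
  shows "(\<forall>x\<in>C. x \<odot> s x = z \<and> (\<forall>w\<in>C. x \<odot> w = z \<longrightarrow> w \<preceq> s x)) \<longleftrightarrow>
    (\<forall>x\<in>C. \<forall>y\<in>C. x \<odot> s x = z \<and> x \<odot> s (x \<odot> y) = x \<odot> s y \<and> x \<odot> s z = x)"
    (is "?L \<longleftrightarrow> ?R")
proof
  assume L: ?L
  have iff: "w \<preceq> s x \<longleftrightarrow> x \<odot> w = z" if "x \<in> C" "w \<in> C" for x w
    using pseudocomplement_at_iff[of x "s x"] L that s by blast
  have "x \<odot> s (x \<odot> y) = x \<odot> s y" if C: "x \<in> C" "y \<in> C" for x y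
  proof (rule below_eqI)
    fix w assume w: "w \<in> C"
    \<comment> \<open>A \<open>w\<close> below \<open>x\<close> is disjoint from
      \<open>x \<odot> y\<close> exactly when it is disjoint from \<open>y\<close>.\<close>
    have "(x \<odot> y) \<odot> w = y \<odot> w" if "w \<preceq> x"
      using that C w unfolding below_def by (metis assoc(2) comm(2))
    then show "w \<preceq> x \<odot> s (x \<odot> y) \<longleftrightarrow> w \<preceq> x \<odot> s y"
      using C w by (auto simp: below_meet_iff iff closed s)
  qed (use C in \<open>auto simp: closed s\<close>)
  moreover have "x \<odot> s z = x" if "x \<in> C" for x
    using iff[of z x] that zero_below closed(3) unfolding below_def by blast
  ultimately show ?R using L by blast
next
  assume R: ?R
  have "w \<preceq> s x" if C: "x \<in> C" "w \<in> C" "x \<odot> w = z" for x w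
  proof -
    \<comment> \<open>The laws are used with \<open>w\<close> in the leading role:
      \<open>w \<odot> x = z\<close>, and \<open>s z\<close> acts as a top element.\<close>
    have "w = w \<odot> s (w \<odot> x)" using R C comm(2) by metis
    also have "\<dots> = w \<odot> s x" using R C by blast
    finally show ?thesis unfolding below_def ..
  qed
  then show ?L using R closed(3) by blast
qed

end

section \<open>Passage from algebra records to the lattice locales\<close>

lemma in_tuples_iff [simp]:
  "xs \<in> tuples A 0 \<longleftrightarrow> xs = []"
  "xs \<in> tuples A (Suc 0) \<longleftrightarrow> (\<exists>x \<in> carrier A. xs = [x])"
  "xs \<in> tuples A 2 \<longleftrightarrow> (\<exists>x \<in> carrier A. \<exists>y \<in> carrier A. xs = [x, y])"
  by (auto simp: tuples_def length_Suc_conv numeral_2_eq_2)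

lemma pseudocomplement_iff:
  "pseudocomplement A s \<longleftrightarrow> (\<forall>x \<in> carrier A. s x \<in> carrier A \<and> meetA A x (s x) = zeroA A \<and>
     (\<forall>w \<in> carrier A. meetA A x w = zeroA A \<longrightarrow> meetA A w (s x) = w))"
  by (auto simp: pseudocomplement_def greatest_def lattice_order_def)

lemma dual_pseudocomplement_iff:
  "dual_pseudocomplement A p \<longleftrightarrow> (\<forall>x \<in> carrier A. p x \<in> carrier A \<and> joinA A x (p x) = oneA A \<and>
     (\<forall>w \<in> carrier A. joinA A x w = oneA A \<longrightarrow> meetA A (p x) w = p x))"
  by (auto simp: dual_pseudocomplement_def least_def lattice_order_def)

lemma heyting_implication_iff:
  "heyting_implication A i \<longleftrightarrow> (\<forall>x \<in> carrier A. \<forall>y \<in> carrier A. i x y \<in> carrier A \<and>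
     meetA A (meetA A x (i x y)) y = meetA A x (i x y) \<and>
     (\<forall>w \<in> carrier A. meetA A (meetA A x w) y = meetA A x w \<longrightarrow> meetA A w (i x y) = w))"
  by (auto simp: heyting_implication_def greatest_def lattice_order_def)

lemma dual_heyting_implication_iff:
  "dual_heyting_implication A c \<longleftrightarrow> (\<forall>x \<in> carrier A. \<forall>y \<in> carrier A. c x y \<in> carrier A \<and>
     meetA A y (joinA A x (c x y)) = y \<and>
     (\<forall>w \<in> carrier A. meetA A y (joinA A x w) = y \<longrightarrow> meetA A (c x y) w = c x y))"
  by (auto simp: dual_heyting_implication_def least_def lattice_order_def)

definition lattice_closed :: "'a alg \<Rightarrow> bool" where
  "lattice_closed A \<longleftrightarrow> zeroA A \<in> carrier A \<and> oneA A \<in> carrier A \<and>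
     (\<forall>x \<in> carrier A. \<forall>y \<in> carrier A. joinA A x y \<in> carrier A \<and> meetA A x y \<in> carrier A)"

lemma lattice_closedI:
  "is_algebra F A \<Longrightarrow> {Join, Meet, Zero, One} \<subseteq> F \<Longrightarrow> lattice_closed A"
  unfolding lattice_closed_def using interp_closed[of F A] by force

lemma bounded_distrib_lattice_on_iff:
  assumes "lattice_closed A"
  shows "bounded_distrib_lattice_on (carrier A) (joinA A) (meetA A) (zeroA A) (oneA A) \<longleftrightarrow>
    bounded_distrib_lattice_reduct A"
proof
  assume "bounded_distrib_lattice_on (carrier A) (joinA A) (meetA A) (zeroA A) (oneA A)"
  then interpret bounded_distrib_lattice_on "carrier A" "joinA A" "meetA A" "zeroA A" "oneA A" .
  show "bounded_distrib_lattice_reduct A"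
    unfolding bounded_distrib_lattice_reduct_def
    by (intro ballI conjI) (rule assoc comm absorb distrib neutral; assumption)+
next
  assume "bounded_distrib_lattice_reduct A"
  note R = this[unfolded bounded_distrib_lattice_reduct_def, rule_format]
  show "bounded_distrib_lattice_on (carrier A) (joinA A) (meetA A) (zeroA A) (oneA A)"
  proof
    fix x y w assume C: "x \<in> carrier A" "y \<in> carrier A" "w \<in> carrier A"
    show "joinA A (joinA A x y) w = joinA A x (joinA A y w)"
      "meetA A (meetA A x y) w = meetA A x (meetA A y w)"
      "meetA A x (joinA A y w) = joinA A (meetA A x y) (meetA A x w)"
      using R[OF C] by blast+
  next
    fix x y assume C: "x \<in> carrier A" "y \<in> carrier A"
    show "joinA A x y = joinA A y x" "meetA A x y = meetA A y x"
      "joinA A x (meetA A x y) = x" "meetA A x (joinA A x y) = x"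
      using R[OF C C(1)] by blast+
  next
    fix x assume C: "x \<in> carrier A"
    show "joinA A x (zeroA A) = x" "meetA A x (oneA A) = x"
      using R[OF C C C] by blast+
  qed (use assms in \<open>auto simp: lattice_closed_def\<close>)
qed

text \<open>The two pseudocomplements are arguments instead of symbols, so the notion also applies
  to signatures in which they are derived from implications.\<close>

definition regular_double_p :: "'a alg \<Rightarrow> ('a \<Rightarrow> 'a) \<Rightarrow> ('a \<Rightarrow> 'a) \<Rightarrow> bool" where
  "regular_double_p A s p \<longleftrightarrow> lattice_closed A \<and> bounded_distrib_lattice_reduct A \<and>
     pseudocomplement A s \<and> dual_pseudocomplement A p \<and> regular A s p"

lemma regular_double_p_on:
  assumes "regular_double_p A s p"
  shows "regular_double_p_on (carrier A) (joinA A) (meetA A) (zeroA A) (oneA A) s p"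
proof -
  have A: "lattice_closed A" "bounded_distrib_lattice_reduct A" "pseudocomplement A s"
      "dual_pseudocomplement A p" "regular A s p"
    using assms unfolding regular_double_p_def by auto
  interpret bounded_distrib_lattice_on "carrier A" "joinA A" "meetA A" "zeroA A" "oneA A"
    using A bounded_distrib_lattice_on_iff by blast
  interpret d: bounded_distrib_lattice_on "carrier A" "meetA A" "joinA A" "oneA A" "zeroA A"
    by (rule dual)
  \<comment> \<open>In the dual lattice the order is reversed, so the characterisation of
    pseudocomplements read there is the one needed for \<open>p\<close>.\<close>
  have d: "d.below x y \<longleftrightarrow> below y x" if "x \<in> carrier A" "y \<in> carrier A" for x y
    using that below_iff_join d.below_def by simp
  show ?thesis
  proof unfold_locales
    fix x assume x: "x \<in> carrier A"
    show s: "s x \<in> carrier A" and p: "p x \<in> carrier A"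
      using A x by (auto simp: pseudocomplement_iff dual_pseudocomplement_iff)
    fix y assume y: "y \<in> carrier A"
    show "below y (s x) \<longleftrightarrow> meetA A x y = zeroA A"
      using pseudocomplement_at_iff[OF x s] A(3) x y
      unfolding pseudocomplement_iff below_def by blast
    show "below (p x) y \<longleftrightarrow> joinA A x y = oneA A"
      using d.pseudocomplement_at_iff[OF x p] A(4) x y p
      unfolding dual_pseudocomplement_iff below_def[symmetric] by (simp add: d)
    have "s y \<in> carrier A" using A y by (auto simp: pseudocomplement_iff)
    then show "below (meetA A x (p x)) (joinA A y (s y))"
      using A(5) x y p comm(1)[of "joinA A y (s y)" "meetA A x (p x)"]
      by (simp add: regular_def below_iff_join closed)
  qed
qed

text \<open>Meant for derived algebras, whose operations are known to agree with the original ones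
  only on the carrier.\<close>

lemma regular_double_p_cong:
  assumes "regular_double_p A s p" "carrier B = carrier A"
    and "zeroA B = zeroA A" "oneA B = oneA A"
    and "\<And>x y. x \<in> carrier A \<Longrightarrow> y \<in> carrier A \<Longrightarrow> joinA B x y = joinA A x y"
    and "\<And>x y. x \<in> carrier A \<Longrightarrow> y \<in> carrier A \<Longrightarrow> meetA B x y = meetA A x y"
    and "\<And>x. x \<in> carrier A \<Longrightarrow> t x = s x" "\<And>x. x \<in> carrier A \<Longrightarrow> q x = p x"
  shows "regular_double_p B t q"
proof -
  have A: "lattice_closed A" "bounded_distrib_lattice_reduct A" "pseudocomplement A s"
      "dual_pseudocomplement A p" "regular A s p"
    using assms(1) unfolding regular_double_p_def by auto
  have cl: "zeroA A \<in> carrier A" "oneA A \<in> carrier A"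
      "\<And>x y. x \<in> carrier A \<Longrightarrow> y \<in> carrier A \<Longrightarrow> joinA A x y \<in> carrier A"
      "\<And>x y. x \<in> carrier A \<Longrightarrow> y \<in> carrier A \<Longrightarrow> meetA A x y \<in> carrier A"
      "\<And>x. x \<in> carrier A \<Longrightarrow> s x \<in> carrier A" "\<And>x. x \<in> carrier A \<Longrightarrow> p x \<in> carrier A"
    using A by (auto simp: lattice_closed_def pseudocomplement_iff dual_pseudocomplement_iff)
  note eq = assms(2-) cl
  have "lattice_closed B" by (simp add: lattice_closed_def eq)
  moreover have "bounded_distrib_lattice_reduct B"
  proof -
    have "bounded_distrib_lattice_reduct B \<longleftrightarrow> bounded_distrib_lattice_reduct A"
      unfolding bounded_distrib_lattice_reduct_def by (simp add: eq)
    then show ?thesis using A(2) by simp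
  qed
  moreover have "pseudocomplement B t" using A(3) by (simp add: pseudocomplement_iff eq)
  moreover have "dual_pseudocomplement B q" using A(4) by (simp add: dual_pseudocomplement_iff eq)
  moreover have "regular B t q" using A(5) by (simp add: regular_def eq)
  ultimately show ?thesis unfolding regular_double_p_def by blast
qed

section \<open>The four classes\<close>

text \<open>After the lattice laws come the identities of \<open>pseudocomplement_equations\<close>,
  their order duals, and (M).\<close>

definition equations_DBLP :: "(trm \<times> trm) set" where
  "equations_DBLP = (let x = Var 0; y = Var 1; w = Var 2; z = App Zero []; u = App One [];
      j = (\<lambda>s t. App Join [s, t]); m = (\<lambda>s t. App Meet [s, t]);
      st = (\<lambda>t. App Star [t]); pl = (\<lambda>t. App Plus [t]) in
    {(j (j x y) w, j x (j y w)), (m (m x y) w, m x (m y w)), (j x y, j y x), (m x y, m y x),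
     (j x (m x y), x), (m x (j x y), x), (m x (j y w), j (m x y) (m x w)), (j x z, x), (m x u, x),
     (m x (st x), z), (m x (st (m x y)), m x (st y)), (m x (st z), x),
     (j x (pl x), u), (j x (pl (j x y)), j x (pl y)), (j x (pl u), x),
     (j (m x (pl x)) (j y (st y)), j y (st y))})"

lemma satisfies_three_variables:
  assumes "vars t \<union> vars t' \<subseteq> {..<3}"
  shows "satisfies A (t, t') \<longleftrightarrow> (\<forall>x \<in> carrier A. \<forall>y \<in> carrier A. \<forall>w \<in> carrier A.
    eval A (nth [x, y, w]) t = eval A (nth [x, y, w]) t')"
proof
  assume sat: "satisfies A (t, t')"
  show "\<forall>x \<in> carrier A. \<forall>y \<in> carrier A. \<forall>w \<in> carrier A.
    eval A (nth [x, y, w]) t = eval A (nth [x, y, w]) t'"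
  proof (intro ballI)
    fix x y w assume c: "x \<in> carrier A" "y \<in> carrier A" "w \<in> carrier A"
    \<comment> \<open>Valuations are total; variables from the fourth on receive \<open>x\<close>,
      an arbitrary carrier element, and do not occur in the terms.\<close>
    define v where "v n = (if n < 3 then [x, y, w] ! n else x)" for n
    have "v \<in> UNIV \<rightarrow> carrier A"
      using c unfolding v_def by (auto simp: less_Suc_eq numeral_3_eq_3)
    moreover have "eval A v s = eval A (nth [x, y, w]) s" if "vars s \<subseteq> {..<3}" for s
      using that by (intro eval_cong_vars) (auto simp: v_def)
    ultimately show "eval A (nth [x, y, w]) t = eval A (nth [x, y, w]) t'"
      using sat assms unfolding satisfies_def by auto
  qed
next
  assume eq: "\<forall>x \<in> carrier A. \<forall>y \<in> carrier A. \<forall>w \<in> carrier A.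
    eval A (nth [x, y, w]) t = eval A (nth [x, y, w]) t'"
  show "satisfies A (t, t')"
    unfolding satisfies_def
  proof
    fix v :: "nat \<Rightarrow> _" assume v: "v \<in> UNIV \<rightarrow> carrier A"
    have "eval A v s = eval A (nth [v 0, v 1, v 2]) s" if s: "vars s \<subseteq> {..<3}" for s
    proof (rule eval_cong_vars)
      fix n assume "n \<in> vars s"
      then consider "n = 0" | "n = 1" | "n = 2" using s by (fastforce simp: less_Suc_eq numeral_3_eq_3 numeral_2_eq_2)
      then show "v n = [v 0, v 1, v 2] ! n" by cases auto
    qed
    then show "eval A v (fst (t, t')) = eval A v (snd (t, t'))"
      using eq v assms by (auto simp: Pi_iff)
  qed
qed

lemma equations_DBLP_iff:
  "(\<forall>e \<in> equations_DBLP. satisfies A e) \<longleftrightarrow>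
    (\<forall>x \<in> carrier A. \<forall>y \<in> carrier A. \<forall>w \<in> carrier A.
       joinA A (joinA A x y) w = joinA A x (joinA A y w) \<and>
       meetA A (meetA A x y) w = meetA A x (meetA A y w) \<and>
       joinA A x y = joinA A y x \<and> meetA A x y = meetA A y x \<and>
       joinA A x (meetA A x y) = x \<and> meetA A x (joinA A x y) = x \<and>
       meetA A x (joinA A y w) = joinA A (meetA A x y) (meetA A x w) \<and>
       joinA A x (zeroA A) = x \<and> meetA A x (oneA A) = x) \<and>
    (\<forall>x \<in> carrier A. \<forall>y \<in> carrier A. meetA A x (starA A x) = zeroA A \<and>
       meetA A x (starA A (meetA A x y)) = meetA A x (starA A y) \<and>
       meetA A x (starA A (zeroA A)) = x) \<and>
    (\<forall>x \<in> carrier A. \<forall>y \<in> carrier A. joinA A x (plusA A x) = oneA A \<and>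
       joinA A x (plusA A (joinA A x y)) = joinA A x (plusA A y) \<and>
       joinA A x (plusA A (oneA A)) = x) \<and>
    (\<forall>x \<in> carrier A. \<forall>y \<in> carrier A.
       joinA A (meetA A x (plusA A x)) (joinA A y (starA A y)) = joinA A y (starA A y))"
  (is "?L \<longleftrightarrow> ?R")
proof -
  have "?L \<longleftrightarrow> (\<forall>e \<in> equations_DBLP. \<forall>x \<in> carrier A. \<forall>y \<in> carrier A. \<forall>w \<in> carrier A.
      eval A (nth [x, y, w]) (fst e) = eval A (nth [x, y, w]) (snd e))"
    by (rule ball_cong[OF refl]) (auto simp: equations_DBLP_def Let_def satisfies_three_variables)
  \<comment> \<open>Many of the identities have fewer than three variables. Dropping an idle bounded
    quantifier is sound only for a nonempty carrier, hence the case distinction.\<close>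
  also have "\<dots> \<longleftrightarrow> ?R"
    unfolding equations_DBLP_def Let_def by (simp only: ball_simps fst_conv snd_conv eval.simps list.map
      nth_Cons_0 One_nat_def nth_Cons_Suc numeral_2_eq_2)
      (cases "carrier A = {}"; simp add: ball_conj_distrib ex_in_conv)
  finally show ?thesis .
qed

text \<open>The only one of the four classes that is axiomatised by hand; the others are varieties
  as images of it.\<close>

lemma variety_RDBLP: "variety sig_DBLP (RDBLP :: 'a alg set)"
  unfolding variety_def
proof (intro exI conjI)
  show "equations_DBLP \<subseteq> trms sig_DBLP \<times> trms sig_DBLP"
    by (simp add: equations_DBLP_def Let_def sig_DBLP_def trms.Var trms.App)
  have "A \<in> RDBLP \<longleftrightarrow> A \<in> models sig_DBLP equations_DBLP" for A :: "'a alg"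
  \<comment> \<open>The equations capture the two pseudocomplements over a bounded distributive
    lattice. If the type or the lattice laws fail, then both sides fail.\<close>
  proof (cases "is_algebra sig_DBLP A \<and> bounded_distrib_lattice_reduct A")
    case True
    have cl: "lattice_closed A"
      using True lattice_closedI[of sig_DBLP A] by (simp add: sig_DBLP_def)
    interpret bounded_distrib_lattice_on "carrier A" "joinA A" "meetA A" "zeroA A" "oneA A"
      using True cl bounded_distrib_lattice_on_iff by blast
    interpret d: bounded_distrib_lattice_on "carrier A" "meetA A" "joinA A" "oneA A" "zeroA A"
      by (rule dual)
    have d: "d.below x y \<longleftrightarrow> below y x" if "x \<in> carrier A" "y \<in> carrier A" for x y
      using that below_iff_join d.below_def by simp
    have s: "starA A x \<in> carrier A" and p: "plusA A x \<in> carrier A" if "x \<in> carrier A" for x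
      using True that interp_closed[of sig_DBLP A] by (auto simp: sig_DBLP_def)
    have "pseudocomplement A (starA A) \<longleftrightarrow>
        (\<forall>x\<in>carrier A. \<forall>y\<in>carrier A. meetA A x (starA A x) = zeroA A \<and>
           meetA A x (starA A (meetA A x y)) = meetA A x (starA A y) \<and>
           meetA A x (starA A (zeroA A)) = x)"
      using pseudocomplement_equations[of "starA A"] s
      by (simp add: pseudocomplement_iff below_def)
    moreover have "dual_pseudocomplement A (plusA A) \<longleftrightarrow>
        (\<forall>x\<in>carrier A. \<forall>y\<in>carrier A. joinA A x (plusA A x) = oneA A \<and>
           joinA A x (plusA A (joinA A x y)) = joinA A x (plusA A y) \<and>
           joinA A x (plusA A (oneA A)) = x)"
      using d.pseudocomplement_equations[of "plusA A"] p
      by (simp add: dual_pseudocomplement_iff d flip: below_def)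
    ultimately show ?thesis
      using True unfolding RDBLP_def models_def mem_Collect_eq equations_DBLP_iff
        bounded_distrib_lattice_reduct_def regular_def by blast
  next
    case False
    then show ?thesis
      unfolding RDBLP_def models_def mem_Collect_eq equations_DBLP_iff
        bounded_distrib_lattice_reduct_def by blast
  qed
  then show "(RDBLP :: 'a alg set) = models sig_DBLP equations_DBLP" by blast
qed

section \<open>The four classes as one family indexed by the signature\<close>

definition star_of :: "opsym set \<Rightarrow> 'a alg \<Rightarrow> 'a \<Rightarrow> 'a" where
  "star_of F A = (if Imp \<in> F then (\<lambda>x. impA A x (zeroA A)) else starA A)"

definition plus_of :: "opsym set \<Rightarrow> 'a alg \<Rightarrow> 'a \<Rightarrow> 'a" where
  "plus_of F A = (if Coimp \<in> F then (\<lambda>x. coimpA A x (oneA A)) else plusA A)"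

definition regular_algebras :: "opsym set \<Rightarrow> 'a alg set" where
  "regular_algebras F = {A. is_algebra F A \<and> regular_double_p A (star_of F A) (plus_of F A) \<and>
     (Imp \<in> F \<longrightarrow> heyting_implication A (impA A)) \<and>
     (Coimp \<in> F \<longrightarrow> dual_heyting_implication A (coimpA A))}"

text \<open>With the eight available symbols exactly four sets qualify, one for each pair of
  choices, and they are the four signatures of the theorem.\<close>

definition admissible :: "opsym set \<Rightarrow> bool" where
  "admissible F \<longleftrightarrow> {Join, Meet, Zero, One} \<subseteq> F \<and> (Star \<in> F \<longleftrightarrow> Imp \<notin> F) \<and> (Plus \<in> F \<longleftrightarrow> Coimp \<notin> F)"

lemma admissible_sigs:
  "admissible sig_DBLP" "admissible sig_DPCH" "admissible sig_PCHd" "admissible sig_DBLH"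
  by (auto simp: admissible_def sig_DBLP_def sig_DPCH_def sig_PCHd_def sig_DBLH_def)

text \<open>The case \<open>y = 0\<close> of the implication, as only 0 lies below 0. It yields the
  pseudocomplement that \<open>RDPCH\<close> and \<open>RDBLH\<close> leave implicit in
  \<open>Imp\<close>.\<close>

lemma pseudocomplement_from_imp:
  assumes "lattice_closed A" "bounded_distrib_lattice_reduct A" "heyting_implication A i"
  shows "pseudocomplement A (\<lambda>x. i x (zeroA A))"
proof -
  interpret bounded_distrib_lattice_on "carrier A" "joinA A" "meetA A" "zeroA A" "oneA A"
    using assms bounded_distrib_lattice_on_iff by blast
  have z: "zeroA A \<in> carrier A" by (rule closed)
  have zb: "meetA A x (zeroA A) = x \<longleftrightarrow> x = zeroA A" if "x \<in> carrier A" for x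
    using below_zero_iff[OF that] by (simp add: below_def)
  show ?thesis
    unfolding pseudocomplement_iff
  proof
    fix x assume x: "x \<in> carrier A"
    note i = bspec[OF bspec[OF assms(3)[unfolded heyting_implication_iff] x] z]
    then show "i x (zeroA A) \<in> carrier A \<and> meetA A x (i x (zeroA A)) = zeroA A \<and>
        (\<forall>w \<in> carrier A. meetA A x w = zeroA A \<longrightarrow> meetA A w (i x (zeroA A)) = w)"
      using x zb closed(2) by metis
  qed
qed

lemma dual_pseudocomplement_from_coimp:
  assumes "lattice_closed A" "bounded_distrib_lattice_reduct A" "dual_heyting_implication A c"
  shows "dual_pseudocomplement A (\<lambda>x. c x (oneA A))"
proof -
  interpret bounded_distrib_lattice_on "carrier A" "joinA A" "meetA A" "zeroA A" "oneA A"
    using assms bounded_distrib_lattice_on_iff by blast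
  have u: "oneA A \<in> carrier A" by (rule closed)
  have ub: "meetA A (oneA A) x = oneA A \<longleftrightarrow> x = oneA A" if "x \<in> carrier A" for x
    using comm(2)[OF u that] neutral(2)[OF that] by simp
  show ?thesis
    unfolding dual_pseudocomplement_iff
  proof
    fix x assume x: "x \<in> carrier A"
    note c = bspec[OF bspec[OF assms(3)[unfolded dual_heyting_implication_iff] x] u]
    then show "c x (oneA A) \<in> carrier A \<and> joinA A x (c x (oneA A)) = oneA A \<and>
        (\<forall>w \<in> carrier A. joinA A x w = oneA A \<longrightarrow> meetA A (c x (oneA A)) w = c x (oneA A))"
      using x ub closed(1) by metis
  qed
qed

lemma regular_algebras_sigs:
  "(RDBLP :: 'z alg set) = regular_algebras sig_DBLP" "(RDPCH :: 'z alg set) = regular_algebras sig_DPCH"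
  "(RPCHd :: 'z alg set) = regular_algebras sig_PCHd" "(RDBLH :: 'z alg set) = regular_algebras sig_DBLH"
proof -
  note defs = regular_algebras_def regular_double_p_def star_of_def plus_of_def
  have c: "is_algebra F A \<Longrightarrow> admissible F \<Longrightarrow> lattice_closed A" for F and A :: "'z alg"
    using lattice_closedI unfolding admissible_def by blast
  note c = c[OF _ admissible_sigs(1)] c[OF _ admissible_sigs(2)] c[OF _ admissible_sigs(3)]
    c[OF _ admissible_sigs(4)]
  have ops: "Imp \<notin> sig_DBLP" "Coimp \<notin> sig_DBLP" "Imp \<in> sig_DPCH" "Coimp \<notin> sig_DPCH"
     "Imp \<notin> sig_PCHd" "Coimp \<in> sig_PCHd" "Imp \<in> sig_DBLH" "Coimp \<in> sig_DBLH"
    by (simp_all add: sig_DBLP_def sig_DPCH_def sig_PCHd_def sig_DBLH_def)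
  have pc:
    "lattice_closed A \<Longrightarrow> bounded_distrib_lattice_reduct A \<Longrightarrow> heyting_implication A (impA A) \<Longrightarrow>
       pseudocomplement A (\<lambda>x. impA A x (zeroA A))"
    "lattice_closed A \<Longrightarrow> bounded_distrib_lattice_reduct A \<Longrightarrow>
       dual_heyting_implication A (coimpA A) \<Longrightarrow>
       dual_pseudocomplement A (\<lambda>x. coimpA A x (oneA A))" for A :: "'z alg"
    by (rule pseudocomplement_from_imp dual_pseudocomplement_from_coimp; assumption)+
  show "(RDBLP :: 'z alg set) = regular_algebras sig_DBLP" unfolding RDBLP_def defs using c by (auto simp: ops)
  show "(RDPCH :: 'z alg set) = regular_algebras sig_DPCH" unfolding RDPCH_def defs using c pc by (auto simp: ops)
  show "(RPCHd :: 'z alg set) = regular_algebras sig_PCHd" unfolding RPCHd_def defs using c pc by (auto simp: ops)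
  show "(RDBLH :: 'z alg set) = regular_algebras sig_DBLH" unfolding RDBLH_def defs using c pc by (auto simp: ops)
qed

section \<open>Interpretations between the double p-signature and the others\<close>

text \<open>The two compound terms spell out \<open>imp\<close> and \<open>coimp\<close>. No target
  signature is mentioned, so one assignment serves all four.\<close>

fun from_DBLP :: "opsym \<Rightarrow> trm" where
  "from_DBLP Imp = (let x = Var 0; y = Var 1; s = (\<lambda>t. App Star [t]) in
     App Meet [s (App Meet [x, s y]), App Join [App Join [App Plus [App Join [x, s x]], s x], y]])"
| "from_DBLP Coimp = (let x = Var 0; y = Var 1; p = (\<lambda>t. App Plus [t]) in
     App Join [p (App Join [x, p y]), App Meet [App Meet [App Star [App Meet [x, p x]], p x], y]])"
| "from_DBLP f = basic f"

text \<open>Here the signature matters: the same pseudocomplement is basic in one signature and an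
  implication with a constant in another.\<close>

definition to_DBLP :: "opsym set \<Rightarrow> opsym \<Rightarrow> trm" where
  "to_DBLP F f =
    (if f = Star \<and> Imp \<in> F then App Imp [Var 0, App Zero []]
     else if f = Plus \<and> Coimp \<in> F then App Coimp [Var 0, App One []]
     else basic f)"

lemma vars_basic: "vars (basic f) = {..<arity f}"
  by (auto simp: basic_def)

lemma interpretation_from_DBLP: "interpretation_of F sig_DBLP from_DBLP"
  unfolding interpretation_of_def
proof
  fix f assume "f \<in> F"
  show "from_DBLP f \<in> trms sig_DBLP \<and> vars (from_DBLP f) \<subseteq> {..<arity f}"
    by (cases f) (auto simp: Let_def sig_DBLP_def vars_basic trms.Var trms.App basic_in_trms)
qed

lemma interpretation_to_DBLP:
  assumes "admissible F"
  shows "interpretation_of sig_DBLP F (to_DBLP F)"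
  using assms unfolding interpretation_of_def to_DBLP_def admissible_def sig_DBLP_def
  by (auto simp: vars_basic intro!: basic_in_trms trms.Var trms.App)

lemma eval_basic_simps:
  "eval A (nth []) (basic Zero) = zeroA A" "eval A (nth []) (basic One) = oneA A"
  "eval A (nth [x]) (basic Star) = starA A x" "eval A (nth [x]) (basic Plus) = plusA A x"
  "eval A (nth [x, y]) (basic Join) = joinA A x y" "eval A (nth [x, y]) (basic Meet) = meetA A x y"
  "eval A (nth [x, y]) (basic Imp) = impA A x y" "eval A (nth [x, y]) (basic Coimp) = coimpA A x y"
  by (simp_all add: eval_basic)

text \<open>The round trip closes because the term implications, evaluated at 0 and at 1, give back
  the original pseudocomplements.\<close>

lemma derived_from_DBLP:
  assumes A: "A \<in> RDBLP" and F: "admissible F"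
  shows "derived F from_DBLP A \<in> regular_algebras F \<and>
    derived sig_DBLP (to_DBLP F) (derived F from_DBLP A) = A"
proof -
  let ?B = "derived F from_DBLP A"
  have algA: "is_algebra sig_DBLP A" and rdp: "regular_double_p A (starA A) (plusA A)"
    using A unfolding regular_algebras_sigs regular_algebras_def
    by (auto simp: star_of_def plus_of_def sig_DBLP_def)
  interpret regular_double_p_on "carrier A" "joinA A" "meetA A" "zeroA A" "oneA A" "starA A" "plusA A"
    using rdp by (rule regular_double_p_on)
  have Fin: "Join \<in> F" "Meet \<in> F" "Zero \<in> F" "One \<in> F" "Imp \<notin> F \<Longrightarrow> Star \<in> F" "Coimp \<notin> F \<Longrightarrow> Plus \<in> F"
    using F unfolding admissible_def by auto
  have ops: "zeroA ?B = zeroA A" "oneA ?B = oneA A"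
    using Fin by (simp_all add: interp_derived eval_basic_simps)
  have ops2: "joinA ?B x y = joinA A x y" "meetA ?B x y = meetA A x y"
      "Imp \<in> F \<Longrightarrow> impA ?B x y = imp x y" "Coimp \<in> F \<Longrightarrow> coimpA ?B x y = coimp x y"
    if "x \<in> carrier A" "y \<in> carrier A" for x y
    using Fin that by (simp_all add: interp_derived eval_basic_simps imp_def coimp_def Let_def)
  \<comment> \<open>Both sides have as lower set the elements disjoint from
    \<open>x\<close>.\<close>
  have imp0: "imp x (zeroA A) = starA A x" if "x \<in> carrier A" for x
    by (rule below_eqI)
      (use that in \<open>simp_all add: imp_closed closed sp_closed below_imp_iff below_s_iff below_zero_iff\<close>)
  \<comment> \<open>Dually, both sides have as upper set the elements whose join with
    \<open>x\<close> is 1.\<close>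
  have coimp1: "coimp x (oneA A) = plusA A x" if x: "x \<in> carrier A" for x
  proof -
    have one_below: "below (oneA A) w \<longleftrightarrow> w = oneA A" if "w \<in> carrier A" for w
      using that below_antisym below_one below_refl closed(4) by blast
    have "below (coimp x (oneA A)) w \<longleftrightarrow> below (plusA A x) w" if "w \<in> carrier A" for w
      using x that by (simp add: coimp_below_iff p_below_iff one_below closed)
    moreover have "coimp x (oneA A) \<in> carrier A" "plusA A x \<in> carrier A"
      using x by (simp_all add: coimp_closed sp_closed closed)
    ultimately show ?thesis using below_antisym below_refl by blast
  qed
  have star: "star_of F ?B x = starA A x" if x: "x \<in> carrier A" for x
  proof (cases "Imp \<in> F")
    case True
    then show ?thesis using x by (simp add: star_of_def ops ops2 imp0 closed)
  next
    case False
    then show ?thesis using Fin x by (simp add: star_of_def interp_derived eval_basic_simps)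
  qed
  have plus: "plus_of F ?B x = plusA A x" if x: "x \<in> carrier A" for x
  proof (cases "Coimp \<in> F")
    case True
    then show ?thesis using x by (simp add: plus_of_def ops ops2 coimp1 closed)
  next
    case False
    then show ?thesis using Fin x by (simp add: plus_of_def interp_derived eval_basic_simps)
  qed
  have algB: "is_algebra F ?B"
    using algA interpretation_from_DBLP by (rule is_algebra_derived)
  have "regular_double_p ?B (star_of F ?B) (plus_of F ?B)"
    using rdp by (rule regular_double_p_cong) (simp_all add: ops ops2 star plus)
  moreover have "heyting_implication ?B (impA ?B)" if "Imp \<in> F"
  proof -
    have "below (meetA A x (imp x y)) y" if "x \<in> carrier A" "y \<in> carrier A" for x y
      using below_imp_iff[of x y "imp x y"] that by (simp add: imp_closed below_refl)
    then show ?thesis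
      using that below_imp_iff imp_closed
      by (simp add: heyting_implication_iff ops2 closed below_def)
  qed
  moreover have "dual_heyting_implication ?B (coimpA ?B)" if "Coimp \<in> F"
  proof -
    have "below y (joinA A x (coimp x y))" if "x \<in> carrier A" "y \<in> carrier A" for x y
      using coimp_below_iff[of x y "coimp x y"] that by (simp add: coimp_closed below_refl)
    then show ?thesis
      using that coimp_below_iff coimp_closed
      by (simp add: dual_heyting_implication_iff ops2 closed below_def)
  qed
  ultimately have B: "?B \<in> regular_algebras F"
    using algB unfolding regular_algebras_def by blast
  have "derived sig_DBLP (to_DBLP F) ?B = A"
  proof (rule algebra_eqI)
    show "is_algebra sig_DBLP (derived sig_DBLP (to_DBLP F) ?B)"
      using algB interpretation_to_DBLP[OF F] by (rule is_algebra_derived)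
    fix f xs assume f: "f \<in> sig_DBLP"
      and xs: "xs \<in> tuples (derived sig_DBLP (to_DBLP F) ?B) (arity f)"
    have "xs \<in> tuples ?B (arity f)" using xs by (simp add: tuples_def)
    with f have "interp (derived sig_DBLP (to_DBLP F) ?B) f xs = eval ?B (nth xs) (to_DBLP F f)"
      by (rule interp_derived)
    also have "\<dots> = interp A f xs"
      using f xs star plus unfolding sig_DBLP_def
      by (auto simp: to_DBLP_def eval_basic_simps ops ops2 star_of_def plus_of_def split: if_splits)
    finally show "interp (derived sig_DBLP (to_DBLP F) ?B) f xs = interp A f xs" .
  qed (use algA in simp_all)
  with B show ?thesis by blast
qed

text \<open>An algebra of type \<open>F\<close> may bring its own implications. They equal the terms
  \<open>imp\<close> and \<open>coimp\<close> because the order leaves only one operation with the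
  required property.\<close>

lemma derived_to_DBLP:
  assumes B: "B \<in> regular_algebras F" and F: "admissible F"
  shows "derived sig_DBLP (to_DBLP F) B \<in> RDBLP \<and>
    derived F from_DBLP (derived sig_DBLP (to_DBLP F) B) = B"
proof -
  let ?A = "derived sig_DBLP (to_DBLP F) B"
  let ?s = "star_of F B" and ?p = "plus_of F B"
  have algB: "is_algebra F B" and rdp: "regular_double_p B ?s ?p"
    and heyt: "Imp \<in> F \<Longrightarrow> heyting_implication B (impA B)"
    and coheyt: "Coimp \<in> F \<Longrightarrow> dual_heyting_implication B (coimpA B)"
    using B unfolding regular_algebras_def by auto
  interpret regular_double_p_on "carrier B" "joinA B" "meetA B" "zeroA B" "oneA B" ?s ?p
    using rdp by (rule regular_double_p_on)
  have sig: "Join \<in> sig_DBLP" "Meet \<in> sig_DBLP" "Zero \<in> sig_DBLP" "One \<in> sig_DBLP"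
      "Star \<in> sig_DBLP" "Plus \<in> sig_DBLP" "Imp \<notin> sig_DBLP" "Coimp \<notin> sig_DBLP"
    by (simp_all add: sig_DBLP_def)
  have ops: "zeroA ?A = zeroA B" "oneA ?A = oneA B"
    using sig by (simp_all add: interp_derived eval_basic_simps to_DBLP_def)
  have ops2: "joinA ?A x y = joinA B x y" "meetA ?A x y = meetA B x y"
    if "x \<in> carrier B" "y \<in> carrier B" for x y
    using sig that by (simp_all add: interp_derived eval_basic_simps to_DBLP_def)
  have star: "starA ?A x = ?s x" and plus: "plusA ?A x = ?p x" if "x \<in> carrier B" for x
    using sig that
    by (simp_all add: interp_derived eval_basic_simps to_DBLP_def star_of_def plus_of_def)
  have algA: "is_algebra sig_DBLP ?A"
    using algB interpretation_to_DBLP[OF F] by (rule is_algebra_derived)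
  have "regular_double_p ?A (starA ?A) (plusA ?A)"
    using rdp by (rule regular_double_p_cong) (simp_all add: ops ops2 star plus)
  then have A: "?A \<in> RDBLP"
    using algA sig by (simp add: regular_algebras_sigs regular_algebras_def star_of_def plus_of_def)
  have imp: "impA B x y = imp x y" if F: "Imp \<in> F" and C: "x \<in> carrier B" "y \<in> carrier B" for x y
  proof (rule below_eqI)
    show i: "impA B x y \<in> carrier B"
      using heyt[OF F] C by (simp add: heyting_implication_iff)
    show "imp x y \<in> carrier B" using C by (rule imp_closed)
    have "below (meetA B x (impA B x y)) y \<and>
        (\<forall>w\<in>carrier B. below (meetA B x w) y \<longrightarrow> below w (impA B x y))"
      using heyt[OF F] C unfolding heyting_implication_iff below_def by simp
    then show "below w (impA B x y) \<longleftrightarrow> below w (imp x y)" if "w \<in> carrier B" for w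
      unfolding relative_pseudocomplement_iff[OF C i] using that C by (simp add: below_imp_iff)
  qed
  have coimp: "coimpA B x y = coimp x y"
    if F: "Coimp \<in> F" and C: "x \<in> carrier B" "y \<in> carrier B" for x y
  proof (rule below_antisym)
    show c: "coimpA B x y \<in> carrier B"
      using coheyt[OF F] C by (simp add: dual_heyting_implication_iff)
    show c': "coimp x y \<in> carrier B" using C by (rule coimp_closed)
    have "below y (joinA B x (coimp x y))"
      using coimp_below_iff[OF C c'] below_refl[OF c'] by blast
    then show "below (coimpA B x y) (coimp x y)"
      using coheyt[OF F] C c' by (simp add: dual_heyting_implication_iff below_def)
    show "below (coimp x y) (coimpA B x y)"
      unfolding coimp_below_iff[OF C c]
      using coheyt[OF F] C by (simp add: dual_heyting_implication_iff below_def)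
  qed
  have "derived F from_DBLP ?A = B"
  proof (rule algebra_eqI)
    show "is_algebra F (derived F from_DBLP ?A)"
      using algA interpretation_from_DBLP by (rule is_algebra_derived)
    fix f xs assume f: "f \<in> F" and "xs \<in> tuples (derived F from_DBLP ?A) (arity f)"
    then have xs: "xs \<in> tuples ?A (arity f)" by (simp add: tuples_def)
    with f have "interp (derived F from_DBLP ?A) f xs = eval ?A (nth xs) (from_DBLP f)"
      by (rule interp_derived)
    also have "\<dots> = interp B f xs"
    proof (cases f)
      case Imp
      then obtain x y where "xs = [x, y]" "x \<in> carrier B" "y \<in> carrier B" using xs by auto
      then show ?thesis
        using Imp f by (simp add: Let_def ops2 star plus closed sp_closed imp imp_def)
    next
      case Coimp
      then obtain x y where "xs = [x, y]" "x \<in> carrier B" "y \<in> carrier B" using xs by auto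
      then show ?thesis
        using Coimp f by (simp add: Let_def ops2 star plus closed sp_closed coimp coimp_def)
    qed (use f xs F in \<open>auto simp: eval_basic_simps ops ops2 star plus star_of_def plus_of_def
        admissible_def\<close>)
    finally show "interp (derived F from_DBLP ?A) f xs = interp B f xs" .
  qed (use algB in simp_all)
  with A show ?thesis by blast
qed

lemma lattice_isomorphic_regular_algebras:
  assumes F: "admissible F"
  shows "lattice_isomorphic (subvarieties sig_DBLP (RDBLP :: 'a alg set))
    (subvarieties F (regular_algebras F :: 'a alg set))"
proof -
  interpret term_equivalence sig_DBLP "RDBLP :: 'a alg set" from_DBLP F "regular_algebras F" "to_DBLP F"
    by unfold_locales
      (use F derived_from_DBLP derived_to_DBLP interpretation_from_DBLP interpretation_to_DBLP in
        \<open>auto simp: RDBLP_def regular_algebras_def\<close>)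
  show ?thesis using variety_RDBLP by (rule lattice_isomorphic_subvarieties)
qed

theorem corollary2p7:
  shows "lattice_isomorphic (subvarieties sig_DBLP (RDBLP :: 'a alg set))
                            (subvarieties sig_DPCH (RDPCH :: 'a alg set))
       \<and> lattice_isomorphic (subvarieties sig_DPCH (RDPCH :: 'a alg set))
                            (subvarieties sig_PCHd (RPCHd :: 'a alg set))
       \<and> lattice_isomorphic (subvarieties sig_PCHd (RPCHd :: 'a alg set))
                            (subvarieties sig_DBLH (RDBLH :: 'a alg set))"
proof -
  note iso = lattice_isomorphic_regular_algebras[OF admissible_sigs(2)]
    lattice_isomorphic_regular_algebras[OF admissible_sigs(3)]
    lattice_isomorphic_regular_algebras[OF admissible_sigs(4)]
  note iso = iso[folded regular_algebras_sigs(2-4)]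
  \<comment> \<open>All available isomorphisms start at \<open>RDBLP\<close>, so neighbouring
    classes are connected through it by reversing one isomorphism and composing with the
    next.\<close>
  show ?thesis
    using iso(1) lattice_isomorphic_trans[OF lattice_isomorphic_sym[OF iso(1)] iso(2)]
      lattice_isomorphic_trans[OF lattice_isomorphic_sym[OF iso(2)] iso(3)] by (intro conjI)
qed

end
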